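(* Let $M$ and $N$ be matroids in $\mathfrak F\oplus\mathfrak F^{*}$ on the same countable ground set $E$. Then there exist a set $I$ independent in both $M$ and $N$ and a partition $E=E_M\sqcup E_N$ such that $I\cap E_M$ spans $E_M$ in $M$ and $I\cap E_N$ spans $E_N$ in $N$.
   Context: Matroids are possibly infinite: a matroid is a pair $M=(E,\mathcal I)$ with $\mathcal I\subseteq\mathcal P(E)$ such that (1) $\varnothing\in\mathcal I$; (2) $\mathcal I$ is closed under subsets; (3) for all $I,J\in\mathcal I$ with $J$ maximal in $\mathcal I$ and $I$ not maximal, there is $e\in J\setminus I$ with $I\cup\{e\}\in\mathcal I$; (4) for every $X\subseteq E$, every $I\in\mathcal I$ with $I\subseteq X$ extends to a maximal element of $\{J\in\mathcal I: J\subseteq X\}$. Circuits are minimal dependent sets. $\mathsf{span}_M(X)$ consists of $X$ together with those $e$ for which there is a circuit $C\ni e$ with $C\setminus\{e\}\subseteq X$; "$A$ spans $B$" means $B\subseteq\mathsf{span}_M(A)$. A matroid is finitary if all its circuits are finite, cofinitary if its dual is finitary; $\mathfrak F\oplus\mathfrak F^*$ is the class of matroids that are a direct sum of a finitary and a cofinitary matroid. *)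

theory Defs
  imports Main "HOL-Library.Countable_Set"
begin

definition maximal_in :: "'a set set \<Rightarrow> 'a set \<Rightarrow> bool" where
  "maximal_in \<F> X \<longleftrightarrow> X \<in> \<F> \<and> (\<forall>Y\<in>\<F>. X \<subseteq> Y \<longrightarrow> Y = X)"

definition matroid :: "'a set \<Rightarrow> 'a set set \<Rightarrow> bool" where
  "matroid E \<I> \<longleftrightarrow>
     (\<forall>I\<in>\<I>. I \<subseteq> E) \<and>
     {} \<in> \<I> \<and>
     (\<forall>I J. I \<in> \<I> \<longrightarrow> J \<subseteq> I \<longrightarrow> J \<in> \<I>) \<and>
     (\<forall>I J. I \<in> \<I> \<longrightarrow> maximal_in \<I> J \<longrightarrow> \<not> maximal_in \<I> I \<longrightarrow>
        (\<exists>e\<in>J - I. insert e I \<in> \<I>)) \<and>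
     (\<forall>X I. X \<subseteq> E \<longrightarrow> I \<in> \<I> \<longrightarrow> I \<subseteq> X \<longrightarrow>
        (\<exists>B. I \<subseteq> B \<and> maximal_in {J\<in>\<I>. J \<subseteq> X} B))"

definition bases :: "'a set set \<Rightarrow> 'a set set" where
  "bases \<I> = {B. maximal_in \<I> B}"

definition circuit :: "'a set \<Rightarrow> 'a set set \<Rightarrow> 'a set \<Rightarrow> bool" where
  "circuit E \<I> C \<longleftrightarrow> C \<subseteq> E \<and> C \<notin> \<I> \<and> (\<forall>D. D \<subset> C \<longrightarrow> D \<in> \<I>)"

definition span :: "'a set \<Rightarrow> 'a set set \<Rightarrow> 'a set \<Rightarrow> 'a set" where
  "span E \<I> X = X \<union> {e. \<exists>C. circuit E \<I> C \<and> e \<in> C \<and> C - {e} \<subseteq> X}"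

definition dual_indep :: "'a set \<Rightarrow> 'a set set \<Rightarrow> 'a set set" where
  "dual_indep E \<I> = {I. \<exists>B\<in>bases \<I>. I \<subseteq> E - B}"

definition finitary :: "'a set \<Rightarrow> 'a set set \<Rightarrow> bool" where
  "finitary E \<I> \<longleftrightarrow> (\<forall>C. circuit E \<I> C \<longrightarrow> finite C)"

definition cofinitary :: "'a set \<Rightarrow> 'a set set \<Rightarrow> bool" where
  "cofinitary E \<I> \<longleftrightarrow> finitary E (dual_indep E \<I>)"

definition restr :: "'a set set \<Rightarrow> 'a set \<Rightarrow> 'a set set" where
  "restr \<I> X = {I\<in>\<I>. I \<subseteq> X}"

definition fin_plus_cofin :: "'a set \<Rightarrow> 'a set set \<Rightarrow> bool" where
  "fin_plus_cofin E \<I> \<longleftrightarrow>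
     (\<exists>E1 E2 \<I>1 \<I>2. E1 \<inter> E2 = {} \<and> E1 \<union> E2 = E \<and>
        matroid E1 \<I>1 \<and> finitary E1 \<I>1 \<and>
        matroid E2 \<I>2 \<and> cofinitary E2 \<I>2 \<and>
        \<I> = {I1 \<union> I2 | I1 I2. I1 \<in> \<I>1 \<and> I2 \<in> \<I>2})"

end

theory Submission
  imports Defs
begin

text \<open>
  Matroids are handled through their closure operators, so that contraction of \<open>Q\<close> is
  \<open>A \<mapsto> cl (A \<union> Q)\<close> and deletion merely shrinks the ground set. A \<^emph>\<open>wave\<close> is a set \<open>W\<close> with some
  \<open>X \<subseteq> W\<close> that spans \<open>W\<close> in \<open>M\<close> and is independent in \<open>N / (E - W)\<close>. Waves can be glued, so there is a
  largest one, and it serves as \<open>E\<^sub>M\<close>. After contracting it there are no nonempty waves, and one has to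
  find an \<open>M\<close>-independent set that spans \<open>N\<close>.

  This set is built together with its complement in countably many steps: a pair \<open>(I, J)\<close> is
  enlarged while keeping the pair \<open>(M / I - J, N / I - J)\<close> free of waves. Putting one element into \<open>I\<close>
  creates no hindrance (a wave with a surplus element), since a hindrance could be augmented to a wave of the
  original pair; the new largest wave is then absorbed. At infinity one needs that every \<open>e \<in> J\<close> where
  \<open>N\<close> is finitary is \<open>N\<close>-spanned by some stage of \<open>I\<close>, and dually for the cofinitary part of \<open>M\<close>; the
  remaining two parts take care of themselves by finitarity.

  For the spanning requirement one repeatedly augments along alternating paths, always for the first element
  for which this is possible. Elements that are never spanned eventually have no augmenting path. From then on
  the sets reachable from them are never touched by later augmentations and only grow, and the union of all
  these reachable sets is a nonempty wave, a contradiction.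
\<close>

section \<open>Closure operators of matroids\<close>

text \<open>Why an \<open>M\<close>-independent set spanning \<open>N\<close> suffices: thinned out
  to an \<open>N\<close>-basis it stays independent over the largest wave in \<open>M\<close>, while
  the witness of that wave is \<open>N\<close>-independent over the complement. The union of the two
  is therefore independent in both matroids. The obstacle is the passage to the limit. If
  \<open>M\<close> has infinite circuits, an increasing union of independent sets may be dependent;
  if the dual of \<open>N\<close> has infinite circuits, the union of the deleted sets may no longer
  be spanned by what remains. Therefore each element on a dangerous part receives a certificate at
  some finite stage: a member of \<open>J\<close> is \<open>N\<close>-spanned by \<open>I\<close>, a
  member of \<open>I\<close> is spanned by \<open>J\<close> in the dual of \<open>M\<close>. Both
  certificates are monotone, so they persist, and duality exchanges them, so that one construction
  provides both.\<close>

definition indep_wrt :: "('a set \<Rightarrow> 'a set) \<Rightarrow> 'a set \<Rightarrow> bool" where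
  "indep_wrt cl A \<longleftrightarrow> (\<forall>x\<in>A. x \<notin> cl (A - {x}))"

text \<open>\<open>base\<close> does the work that counting or Zorn's lemma does for finite
  circuits. There is no ground set: the operator acts on all sets of the type, and the ambient set
  \<open>S\<close> of \<open>base\<close> varies.\<close>

locale closure_matroid =
  fixes cl :: "'a set \<Rightarrow> 'a set"
  assumes ext: "A \<subseteq> cl A"
    and mono: "A \<subseteq> B \<Longrightarrow> cl A \<subseteq> cl B"
    and idem: "cl (cl A) \<subseteq> cl A"
    and exch: "y \<in> cl (insert x A) \<Longrightarrow> y \<notin> cl A \<Longrightarrow> x \<in> cl (insert y A)"
    and base: "indep_wrt cl A \<Longrightarrow> A \<subseteq> S \<Longrightarrow> \<exists>B. A \<subseteq> B \<and> B \<subseteq> S \<and> indep_wrt cl B \<and> S \<subseteq> cl B"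
begin

lemma least: "A \<subseteq> cl B \<Longrightarrow> cl A \<subseteq> cl B"
  using mono[of A "cl B"] idem by blast

lemma in_trans: "x \<in> cl A \<Longrightarrow> A \<subseteq> cl B \<Longrightarrow> x \<in> cl B"
  using least by blast

lemma in_mono: "x \<in> cl A \<Longrightarrow> A \<subseteq> B \<Longrightarrow> x \<in> cl B"
  using mono by blast

lemma in_ext: "x \<in> A \<Longrightarrow> x \<in> cl A"
  using ext[of A] by blast

lemma indep_subset: "indep_wrt cl A \<Longrightarrow> B \<subseteq> A \<Longrightarrow> indep_wrt cl B"
  unfolding indep_wrt_def using in_mono[of _ "B - {_}" "A - {_}"] by blast

lemma indep_empty: "indep_wrt cl {}"
  by (simp add: indep_wrt_def)

lemma indep_insert:
  assumes "indep_wrt cl A" "x \<notin> cl A"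
  shows "indep_wrt cl (insert x A)"
  unfolding indep_wrt_def
proof (intro ballI notI)
  fix y assume y: "y \<in> insert x A" "y \<in> cl (insert x A - {y})"
  have "x \<notin> A" using assms(2) in_ext by blast
  show False
  proof (cases "y = x")
    case True
    then show ?thesis using y assms(2) \<open>x \<notin> A\<close> by simp
  next
    case False
    then have "y \<in> A" "insert x A - {y} = insert x (A - {y})" using y by auto
    moreover have "y \<notin> cl (A - {y})" using assms(1) \<open>y \<in> A\<close> by (simp add: indep_wrt_def)
    ultimately have "x \<in> cl (insert y (A - {y}))" using exch y by metis
    then show False using assms(2) \<open>y \<in> A\<close> by (simp add: insert_absorb)
  qed
qed

text \<open>A basis \<open>D\<close> of \<open>A \<union> B\<close> that extends \<open>B\<close>
  must contain every \<open>a\<close> in \<open>A\<close>: otherwise \<open>D\<close> lies in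
  \<open>A - {a}\<close> together with \<open>Q\<close>, and \<open>a\<close> would be spanned over
  \<open>Q\<close>.\<close>

lemma indep_Un:
  assumes "indep_wrt cl B" "indep_wrt (\<lambda>A. cl (A \<union> Q)) A" "B \<subseteq> Q"
  shows "indep_wrt cl (A \<union> B)"
proof -
  obtain D where D: "B \<subseteq> D" "D \<subseteq> A \<union> B" "indep_wrt cl D" "A \<union> B \<subseteq> cl D"
    using base[OF assms(1), of "A \<union> B"] by auto
  have "A \<subseteq> D"
  proof
    fix a assume a: "a \<in> A"
    show "a \<in> D"
    proof (rule ccontr)
      assume "a \<notin> D"
      then have "D \<subseteq> (A - {a}) \<union> Q" using D assms(3) by auto
      then have "a \<in> cl ((A - {a}) \<union> Q)" using D(4) a mono[of D "(A - {a}) \<union> Q"] by blast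
      then show False using assms(2) a by (simp add: indep_wrt_def)
    qed
  qed
  then have "D = A \<union> B" using D by auto
  then show ?thesis using D by simp
qed

text \<open>With \<open>T\<close> replaced by a basis, \<open>x\<close> joins an independent subset
  of \<open>Q\<close>, which stays independent when \<open>A\<close> is added. Used to see that the
  witness of a wave spans nothing new outside the wave.\<close>

lemma over_not_in:
  assumes A: "indep_wrt (\<lambda>A. cl (A \<union> Q)) A" and "T \<subseteq> Q" "x \<in> Q" "x \<notin> cl T"
  shows "x \<notin> cl (T \<union> A)"
proof
  assume x: "x \<in> cl (T \<union> A)"
  obtain B where B: "B \<subseteq> T" "indep_wrt cl B" "T \<subseteq> cl B"
    using base[OF indep_empty, of T] by auto
  have "x \<notin> cl B" using B(1) assms(4) mono[of B T] by blast
  then have i: "indep_wrt cl (insert x B)" using B(2) indep_insert by blast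
  have "indep_wrt cl (A \<union> insert x B)"
    using indep_Un[OF i A] B assms by auto
  then have n: "x \<notin> cl (A \<union> insert x B - {x})" by (simp add: indep_wrt_def)
  have "x \<notin> A"
  proof
    assume "x \<in> A"
    moreover have "x \<in> cl (A - {x} \<union> Q)" by (rule in_ext) (simp add: assms(3))
    ultimately show False using A by (simp add: indep_wrt_def)
  qed
  moreover have "x \<notin> B" using \<open>x \<notin> cl B\<close> in_ext[of x B] by blast
  ultimately have "A \<union> insert x B - {x} = A \<union> B" by auto
  moreover have "T \<union> A \<subseteq> cl (A \<union> B)" using B ext[of "A \<union> B"] mono[of B "A \<union> B"] by blast
  then have "x \<in> cl (A \<union> B)" by (rule in_trans[OF x])
  ultimately show False using n by simp
qed

text \<open>The complement of \<open>S\<close> contains the fundamental circuit of \<open>y\<close>,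
  and an infinite \<open>S\<close> cannot be removed one element at a time. If the removal failed, a
  basis of \<open>insert y X\<close> through \<open>insert y (X - S)\<close> would omit some
  \<open>x\<close> in \<open>S\<close>; but \<open>X - {x}\<close> spans \<open>y\<close>, hence
  this basis, hence \<open>x\<close>.\<close>

lemma removable:
  assumes X: "indep_wrt cl X" and y: "y \<in> cl X" and S: "S \<subseteq> X" "\<And>x. x \<in> S \<Longrightarrow> y \<in> cl (X - {x})"
  shows "y \<in> cl (X - S)"
proof (rule ccontr)
  assume n: "y \<notin> cl (X - S)"
  have yX: "y \<notin> X"
  proof
    assume "y \<in> X"
    then have "y \<in> S" using n in_ext[of y "X - S"] by blast
    then show False using S X \<open>y \<in> X\<close> by (auto simp: indep_wrt_def)
  qed
  have "indep_wrt cl (insert y (X - S))" by (rule indep_insert[OF indep_subset[OF X] n]) blast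
  then obtain B where B: "insert y (X - S) \<subseteq> B" "B \<subseteq> insert y X" "indep_wrt cl B" "insert y X \<subseteq> cl B"
    using base[of "insert y (X - S)" "insert y X"] by auto
  have "\<not> X \<subseteq> B"
  proof
    assume "X \<subseteq> B"
    then have "B = insert y X" using B by auto
    then show False using B y yX by (simp add: indep_wrt_def)
  qed
  then obtain x where x: "x \<in> X" "x \<notin> B" by blast
  then have "x \<in> S" using B by auto
  have "B \<subseteq> cl (X - {x})" using B(2) x S(2)[OF \<open>x \<in> S\<close>] ext[of "X - {x}"] by blast
  moreover have "x \<in> cl B" using B(4) x by blast
  ultimately have "x \<in> cl (X - {x})" by (metis in_trans)
  then show False using X x by (simp add: indep_wrt_def)
qed

text \<open>If \<open>A\<close> needed \<open>x\<close> to span \<open>y\<close>, exchange would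
  recover \<open>x\<close> from \<open>y\<close> and \<open>A - {x}\<close>, hence from
  \<open>X - {x}\<close>, against independence.\<close>

lemma in_Diff_single:
  assumes X: "indep_wrt cl X" and "A \<subseteq> X" "y \<in> cl A" "y \<in> cl (X - {x})"
  shows "y \<in> cl (A - {x})"
proof (rule ccontr)
  assume n: "y \<notin> cl (A - {x})"
  then have xA: "x \<in> A" using assms(3) by (metis Diff_empty Diff_insert0)
  then have "x \<in> cl (insert y (A - {x}))" using exch[of y x "A - {x}"] n assms by (simp add: insert_absorb)
  moreover have "insert y (A - {x}) \<subseteq> cl (X - {x})" using assms(2,4) ext[of "X - {x}"] by blast
  ultimately have "x \<in> cl (X - {x})" by (rule in_trans)
  then show False using X xA assms by (auto simp: indep_wrt_def)
qed

text \<open>For \<open>base\<close>: a basis \<open>B\<close> of \<open>Q\<close> turns independence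
  over \<open>Q\<close> into plain independence of \<open>A \<union> B\<close>. A basis
  \<open>D\<close> of \<open>S \<union> B\<close> through this set yields
  \<open>D - B\<close>.\<close>

lemma contract: "closure_matroid (\<lambda>A. cl (A \<union> Q))"
proof
  fix A show "A \<subseteq> cl (A \<union> Q)" using ext[of "A \<union> Q"] by blast
next
  fix A B :: "'a set" assume "A \<subseteq> B" then show "cl (A \<union> Q) \<subseteq> cl (B \<union> Q)" by (intro mono) auto
next
  fix A show "cl (cl (A \<union> Q) \<union> Q) \<subseteq> cl (A \<union> Q)" using ext[of "A \<union> Q"] by (intro least) blast
next
  fix x y A assume "y \<in> cl (insert x A \<union> Q)" "y \<notin> cl (A \<union> Q)"
  then show "x \<in> cl (insert y A \<union> Q)" using exch[of y x "A \<union> Q"] by simp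
next
  fix A S assume A: "indep_wrt (\<lambda>A. cl (A \<union> Q)) A" "A \<subseteq> S"
  obtain B where B: "B \<subseteq> Q" "indep_wrt cl B" "Q \<subseteq> cl B"
    using base[OF indep_empty, of Q] by auto
  have disj: "A \<inter> Q = {}"
  proof -
    have "x \<in> cl (A - {x} \<union> Q)" if "x \<in> Q" for x by (rule in_ext) (simp add: that)
    then show ?thesis using A(1) by (auto simp: indep_wrt_def)
  qed
  have "indep_wrt cl (A \<union> B)" using indep_Un[OF B(2) A(1) B(1)] .
  then obtain D where D: "A \<union> B \<subseteq> D" "D \<subseteq> S \<union> B" "indep_wrt cl D" "S \<union> B \<subseteq> cl D"
    using base[of "A \<union> B" "S \<union> B"] A(2) by blast
  show "\<exists>B. A \<subseteq> B \<and> B \<subseteq> S \<and> indep_wrt (\<lambda>A. cl (A \<union> Q)) B \<and> S \<subseteq> cl (B \<union> Q)"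
  proof (intro exI[of _ "D - B"] conjI)
    show "A \<subseteq> D - B" using D disj B by auto
    show "D - B \<subseteq> S" using D by auto
    show "S \<subseteq> cl (D - B \<union> Q)" using D(4) B(1) mono[of D "D - B \<union> Q"] by blast
    show "indep_wrt (\<lambda>A. cl (A \<union> Q)) (D - B)" unfolding indep_wrt_def
    proof (intro ballI notI)
      fix x assume x: "x \<in> D - B" "x \<in> cl (D - B - {x} \<union> Q)"
      have "D - B - {x} \<union> Q \<subseteq> cl (D - {x})"
        using x(1) D(1) B(3) ext[of "D - {x}"] mono[of B "D - {x}"] by blast
      then have "x \<in> cl (D - {x})" by (rule in_trans[OF x(2)])
      then show False using D x by (simp add: indep_wrt_def)
    qed
  qed
qed

lemma eq_of_subset: "A \<subseteq> cl B \<Longrightarrow> B \<subseteq> cl A \<Longrightarrow> cl A = cl B"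
  using least[of A B] least[of B A] by blast

lemma exchange_span:
  assumes "y \<in> cl A" "y \<notin> cl (A - {x})"
  shows "x \<in> cl (insert y (A - {x}))" "cl (insert y (A - {x})) = cl A"
proof -
  have xA: "x \<in> A" using assms by (metis Diff_empty Diff_insert0)
  show 1: "x \<in> cl (insert y (A - {x}))" using exch[of y x "A - {x}"] assms xA by (simp add: insert_absorb)
  show "cl (insert y (A - {x})) = cl A"
  proof (rule eq_of_subset)
    show "insert y (A - {x}) \<subseteq> cl A" using assms(1) ext[of A] by blast
    show "A \<subseteq> cl (insert y (A - {x}))" using 1 ext[of "insert y (A - {x})"] by blast
  qed
qed

lemma indep_exchange:
  assumes X: "indep_wrt cl X" and "y \<notin> cl (X - {x})"
  shows "indep_wrt cl (insert y (X - {x}))"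
  by (rule indep_insert[OF indep_subset[OF X] assms(2)]) blast

end

text \<open>The passage from \<open>y i\<close> to \<open>x i\<close> runs along the fundamental
  circuit of \<open>y i\<close> in \<open>M\<close>, that from \<open>x i\<close> to
  \<open>y (Suc i)\<close> along the one of \<open>y (Suc i)\<close> in \<open>N\<close>. Nothing is
  demanded of the last vertex with respect to \<open>M\<close>: the walk is augmenting if
  \<open>y k\<close> lies outside \<open>M X\<close>.\<close>

definition alt_walk ::
    "('a set \<Rightarrow> 'a set) \<Rightarrow> ('a set \<Rightarrow> 'a set) \<Rightarrow> 'a set \<Rightarrow> nat \<Rightarrow> (nat \<Rightarrow> 'a) \<Rightarrow> (nat \<Rightarrow> 'a) \<Rightarrow> bool" where
  "alt_walk M N X k y x \<longleftrightarrow> y 0 \<notin> N X \<and>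
     (\<forall>i<k. x i \<in> X \<and> y i \<in> M X \<and> y i \<notin> M (X - {x i}) \<and>
        y (Suc i) \<notin> X \<and> y (Suc i) \<in> N X \<and> y (Suc i) \<notin> N (X - {x i}))"

text \<open>Only the vertices outside \<open>X\<close> are recorded; the vertices in \<open>X\<close> that are passed on the way are
  those \<open>x\<close> with \<open>y \<notin> M (X - {x})\<close> for a reached \<open>y\<close>.\<close>

inductive_set alt_reach for M N :: "'a set \<Rightarrow> 'a set" and X V S :: "'a set" where
  src: "y \<in> S \<Longrightarrow> y \<in> alt_reach M N X V S"
| step: "y \<in> alt_reach M N X V S \<Longrightarrow> y \<in> M X \<Longrightarrow> x \<in> X \<Longrightarrow> y \<notin> M (X - {x}) \<Longrightarrow>
    y' \<in> V \<Longrightarrow> y' \<notin> X \<Longrightarrow> y' \<in> N X \<Longrightarrow> y' \<notin> N (X - {x}) \<Longrightarrow> y' \<in> alt_reach M N X V S"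

lemma alt_reach_walk:
  assumes "c \<in> alt_reach M N X V S" "S \<inter> N X = {}"
  shows "\<exists>k y x. alt_walk M N X k y x \<and> y 0 \<in> S \<and> y k = c \<and> (\<forall>i\<le>k. y i \<in> alt_reach M N X V S)"
  using assms(1)
proof induction
  case (src y)
  then show ?case using assms(2)
    by (intro exI[of _ 0] exI[of _ "\<lambda>_. y"] exI) (auto simp: alt_walk_def intro: alt_reach.src)
next
  case (step y x y')
  then obtain k ys xs where w: "alt_walk M N X k ys xs" "ys 0 \<in> S" "ys k = y"
      "\<forall>i\<le>k. ys i \<in> alt_reach M N X V S" by blast
  have "y' \<in> alt_reach M N X V S" using step alt_reach.step[of y M N X V S x y'] by blast
  with w step show ?case
    by (intro exI[of _ "Suc k"] exI[of _ "ys(Suc k := y')"] exI[of _ "xs(k := x)"])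
       (auto simp: alt_walk_def less_Suc_eq)
qed

lemma alt_reach_cases: "y \<in> alt_reach M N X V S \<Longrightarrow> y \<in> S \<or> y \<in> V \<and> y \<notin> X \<and> y \<in> N X"
  by (erule alt_reach.cases) auto

section \<open>Pairs of matroids and augmentation along alternating walks\<close>

locale closure_pair = M: closure_matroid M + N: closure_matroid N
  for M N :: "'a set \<Rightarrow> 'a set"
begin

text \<open>Shortcuts make the walk shorter; without shortcuts, exchanging \<open>x 0\<close> for \<open>y 0\<close> leaves a shorter walk.
  The set \<open>T\<close> consists of elements that must not be exchanged.\<close>

lemma augment:
  assumes "indep_wrt M X" "indep_wrt N X" "T \<subseteq> X" "alt_walk M N X k y x" "y k \<notin> M X"
    "\<And>i. i < k \<Longrightarrow> x i \<notin> T \<and> y (Suc i) \<in> N (X - T)"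
  shows "\<exists>X'. X' \<subseteq> X \<union> y ` {..k} \<and> T \<subseteq> X' \<and> y k \<in> X' \<and> indep_wrt M X' \<and> indep_wrt N X' \<and>
    M X' = M (insert (y k) X) \<and> N (X' - T) = N (insert (y 0) (X - T))"
  using assms
proof (induction k arbitrary: X y x rule: less_induct)
  case (less k)
  note MX = less.prems(1) and NX = less.prems(2) and TX = less.prems(3) and walk = less.prems(4)
    and sink = less.prems(5) and froz = less.prems(6)
  have y0: "y 0 \<notin> N X" using walk by (simp add: alt_walk_def)
  have w: "x i \<in> X" "y i \<in> M X" "y i \<notin> M (X - {x i})" "y (Suc i) \<notin> X" "y (Suc i) \<in> N X"
      "y (Suc i) \<notin> N (X - {x i})" if "i < k" for i
    using walk that by (auto simp: alt_walk_def)
  have y0X: "y 0 \<notin> X" using y0 N.in_ext by blast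
  \<comment> \<open>One round exchanges only \<open>y 0\<close> and \<open>x 0\<close>, so only arcs
    leaving these two vertices can spoil the rest of the walk.\<close>
  consider (zero) "k = 0"
    | (s1) j where "0 < j" "j < k" "y 0 \<notin> M (X - {x j})"
    | (s2) j where "1 < j" "j \<le> k" "y j \<notin> N (X - {x 0})"
    | (main) "0 < k" "\<And>j. 0 < j \<Longrightarrow> j < k \<Longrightarrow> y 0 \<in> M (X - {x j})"
        "\<And>j. 1 < j \<Longrightarrow> j \<le> k \<Longrightarrow> y j \<in> N (X - {x 0})"
    by (metis neq0_conv)
  then show ?case
  proof cases
    case zero
    have "insert (y 0) X - T = insert (y 0) (X - T)" using y0X TX by auto
    then show ?thesis using zero MX NX TX sink y0 M.indep_insert N.indep_insert
      by (intro exI[of _ "insert (y 0) X"]) auto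
  next
    case s1
    define y' where "y' = (\<lambda>i. if i = 0 then y 0 else y (i + j))"
    define x' where "x' = (\<lambda>i. x (i + j))"
    have l: "k - j < k" using s1 by simp
    have "y' (k - j) = y k" "y' 0 = y 0" using s1 by (auto simp: y'_def)
    moreover have "y' ` {..k - j} \<subseteq> y ` {..k}" using s1 by (auto simp: y'_def)
    moreover have "\<exists>X'. X' \<subseteq> X \<union> y' ` {..k - j} \<and> T \<subseteq> X' \<and> y' (k - j) \<in> X' \<and> indep_wrt M X' \<and> indep_wrt N X' \<and>
        M X' = M (insert (y' (k - j)) X) \<and> N (X' - T) = N (insert (y' 0) (X - T))"
    proof (rule less.IH[OF l MX NX TX, where x = x'])
      have "y 0 \<in> M X" using w(2)[of 0] s1 by simp
      then show "alt_walk M N X (k - j) y' x'"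
        using s1 y0 w[of "_ + j"] by (auto simp: alt_walk_def y'_def x'_def)
      show "y' (k - j) \<notin> M X" using calculation sink by simp
      show "x' i \<notin> T \<and> y' (Suc i) \<in> N (X - T)" if "i < k - j" for i
        using that froz[of "i + j"] by (auto simp: y'_def x'_def)
    qed
    ultimately show ?thesis by (smt (verit) Un_mono order_refl order_trans)
  next
    case s2
    \<comment> \<open>In the previous case the walk went from \<open>y 0\<close> straight to
      \<open>x j\<close>, whence the shift by \<open>j\<close>. Here \<open>y j\<close> follows
      \<open>x 0\<close>, so the shift is \<open>j - 1\<close> and \<open>x 0\<close> is
      kept.\<close>
    define y' where "y' = (\<lambda>i. if i = 0 then y 0 else y (i + (j - 1)))"
    define x' where "x' = (\<lambda>i. if i = 0 then x 0 else x (i + (j - 1)))"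
    define k' where "k' = k - (j - 1)"
    have l: "k' < k" using s2 by (simp add: k'_def)
    have "y' k' = y k" "y' 0 = y 0" using s2 by (auto simp: y'_def k'_def)
    moreover have "y' ` {..k'} \<subseteq> y ` {..k}" using s2 by (auto simp: y'_def k'_def)
    moreover have "\<exists>X'. X' \<subseteq> X \<union> y' ` {..k'} \<and> T \<subseteq> X' \<and> y' k' \<in> X' \<and> indep_wrt M X' \<and> indep_wrt N X' \<and>
        M X' = M (insert (y' k') X) \<and> N (X' - T) = N (insert (y' 0) (X - T))"
    proof (rule less.IH[OF l MX NX TX, where x = x'])
      have j: "y j \<in> N X" "y j \<notin> X" "y j \<in> N (X - T)" using s2 w(5)[of "j - 1"] w(4)[of "j - 1"] froz[of "j - 1"] by auto
      then show "alt_walk M N X k' y' x'"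
        using s2 y0 w[of 0] w[of "_ + (j - 1)"] by (auto simp: alt_walk_def y'_def x'_def k'_def)
      show "y' k' \<notin> M X" using calculation sink by simp
      show "x' i \<notin> T \<and> y' (Suc i) \<in> N (X - T)" if "i < k'" for i
        using that froz[of "i + (j - 1)"] froz[of 0] s2 j by (auto simp: y'_def x'_def k'_def)
    qed
    ultimately show ?thesis by (smt (verit) Un_mono order_refl order_trans)
  next
    case main
    define X1 where "X1 = insert (y 0) (X - {x 0})"
    define y' where "y' = (\<lambda>i. y (Suc i))"
    define x' where "x' = (\<lambda>i. x (Suc i))"
    have w0: "x 0 \<in> X" "y 0 \<in> M X" "y 0 \<notin> M (X - {x 0})" "y 1 \<notin> X" "y 1 \<in> N X" "y 1 \<notin> N (X - {x 0})"
      using w[of 0] main(1) by auto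
    have MX1: "M X1 = M X" using M.exchange_span[of "y 0" X "x 0"] w0 by (simp add: X1_def)
    have iM: "indep_wrt M X1" using M.indep_exchange MX w0 by (simp add: X1_def)
    have iN: "indep_wrt N X1" unfolding X1_def
      by (rule N.indep_exchange[OF NX]) (use y0 N.mono[of "X - {x 0}" X] in blast)
    have TX1: "T \<subseteq> X1" using TX froz[of 0] main(1) by (auto simp: X1_def)
    have x0y0: "x 0 \<noteq> y 0" using w0 y0X by auto
    have Suc_ne: "y (Suc i) \<noteq> y 0" if "i < k" for i using w(5)[OF that] y0 by auto
    have TD: "X1 - T = insert (y 0) (X - T - {x 0})" using TX y0X by (auto simp: X1_def)
    have src': "y 1 \<notin> N X1"
    proof
      assume "y 1 \<in> N X1"
      then have "y 0 \<in> N (insert (y 1) (X - {x 0}))" unfolding X1_def by (rule N.exch[OF _ w0(6)])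
      moreover have "insert (y 1) (X - {x 0}) \<subseteq> N X" using w0(5) N.ext[of X] by blast
      ultimately show False using y0 N.in_trans[of "y 0"] by metis
    qed
    have "\<exists>X'. X' \<subseteq> X1 \<union> y' ` {..k - 1} \<and> T \<subseteq> X' \<and> y' (k - 1) \<in> X' \<and> indep_wrt M X' \<and> indep_wrt N X' \<and>
        M X' = M (insert (y' (k - 1)) X1) \<and> N (X' - T) = N (insert (y' 0) (X1 - T))"
    proof (rule less.IH[OF _ iM iN TX1, where x = x'])
      show "k - 1 < k" using main by simp
      show "y' (k - 1) \<notin> M X1" using sink MX1 main by (simp add: y'_def)
      have *: "x (Suc i) \<noteq> x 0" if "Suc i < k" for i
        using main(2)[of "Suc i"] that w0 by auto
      have **: "X1 - {x (Suc i)} = insert (y 0) (X - {x (Suc i)} - {x 0})" if "Suc i < k" for i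
        using w(1)[OF that] y0X by (auto simp: X1_def)
      \<comment> \<open>The vertex is spanned without \<open>T\<close> and also without
        \<open>x 0\<close>; independence merges the two facts, so the condition on \<open>T\<close>
        survives the exchange.\<close>
      have y2: "y (Suc (Suc i)) \<in> N (X - T - {x 0})" if "Suc i < k" for i
        using N.in_Diff_single[OF NX, of "X - T"] froz[OF that] main(3)[of "Suc (Suc i)"] that by auto
      show "alt_walk M N X1 (k - 1) y' x'"
        unfolding alt_walk_def
      proof (intro conjI allI impI)
        show "y' 0 \<notin> N X1" using src' by (simp add: y'_def)
        fix i assume "i < k - 1"
        then have i: "Suc i < k" by simp
        show "x' i \<in> X1" using w(1)[OF i] *[OF i] by (simp add: x'_def X1_def)
        show "y' i \<in> M X1" using w(2)[OF i] MX1 by (simp add: y'_def)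
        show "y' i \<notin> M (X1 - {x' i})"
        proof
          assume "y' i \<in> M (X1 - {x' i})"
          moreover have "X1 - {x' i} \<subseteq> M (X - {x (Suc i)})"
            unfolding x'_def **[OF i] using main(2)[of "Suc i"] i M.ext[of "X - {x (Suc i)}"] by auto
          ultimately show False using M.in_trans[of "y' i"] w(3)[OF i] unfolding y'_def by metis
        qed
        show "y' (Suc i) \<notin> X1" using w(4)[OF i] Suc_ne[OF i] by (simp add: X1_def y'_def)
        show "y' (Suc i) \<in> N X1" using y2[OF i] N.mono[of "X - T - {x 0}" X1] unfolding y'_def by (auto simp: X1_def)
        show "y' (Suc i) \<notin> N (X1 - {x' i})"
        proof
          assume "y' (Suc i) \<in> N (X1 - {x' i})"
          then have "y (Suc (Suc i)) \<in> N (insert (y 0) (X - {x (Suc i)} - {x 0}))"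
            using **[OF i] by (simp add: y'_def x'_def)
          moreover have "y (Suc (Suc i)) \<notin> N (X - {x (Suc i)} - {x 0})"
            using w(6)[OF i] N.mono[of "X - {x (Suc i)} - {x 0}" "X - {x (Suc i)}"] by blast
          ultimately have "y 0 \<in> N (insert (y (Suc (Suc i))) (X - {x (Suc i)} - {x 0}))"
            by (rule N.exch)
          moreover have "insert (y (Suc (Suc i))) (X - {x (Suc i)} - {x 0}) \<subseteq> N X"
            using w(5)[OF i] N.ext[of X] by blast
          ultimately show False using y0 N.in_trans[of "y 0"] by metis
        qed
      qed
      show "x' i \<notin> T \<and> y' (Suc i) \<in> N (X1 - T)" if "i < k - 1" for i
      proof -
        have i: "Suc i < k" using that by simp
        show ?thesis using froz[OF i] y2[OF i] N.mono[of "X - T - {x 0}" "X1 - T"] unfolding x'_def y'_def by (auto simp: TD)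
      qed
    qed
    then obtain X' where X': "X' \<subseteq> X1 \<union> y' ` {..k - 1}" "T \<subseteq> X'" "y' (k - 1) \<in> X'" "indep_wrt M X'" "indep_wrt N X'"
        "M X' = M (insert (y' (k - 1)) X1)" "N (X' - T) = N (insert (y' 0) (X1 - T))" by blast
    have yk: "y' (k - 1) = y k" using main by (simp add: y'_def)
    have "M (insert (y k) X1) = M (insert (y k) X)"
    proof (rule M.eq_of_subset)
      show "insert (y k) X1 \<subseteq> M (insert (y k) X)"
        using MX1 M.ext[of X1] M.mono[of X "insert (y k) X"] M.ext[of "insert (y k) X"] by blast
      show "insert (y k) X \<subseteq> M (insert (y k) X1)"
        using MX1 M.ext[of X] M.mono[of X1 "insert (y k) X1"] M.ext[of "insert (y k) X1"] by blast
    qed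
    moreover have "N (insert (y 1) (X1 - T)) = N (insert (y 0) (X - T))"
    proof -
      \<comment> \<open>\<open>y 1\<close> and \<open>x 0\<close> trade places inside
        \<open>X - T\<close> without changing its \<open>N\<close>-span. So adding the new source
        \<open>y 1\<close> after the exchange has the effect of adding \<open>y 0\<close> before
        it.\<close>
      have "N (insert (y 1) (X - T - {x 0})) = N (X - T)"
        using N.exchange_span(2)[of "y 1" "X - T" "x 0"] froz[of 0] main(1) w0(6) N.in_mono[of "y 1" "X - T - {x 0}" "X - {x 0}"]
        by (metis Diff_mono Diff_subset One_nat_def order_refl)
      then have e: "X - T \<subseteq> N (insert (y 1) (X - T - {x 0}))" "insert (y 1) (X - T - {x 0}) \<subseteq> N (X - T)"
        using N.ext[of "X - T"] N.ext[of "insert (y 1) (X - T - {x 0})"] by blast+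
      show ?thesis unfolding TD
      proof (rule N.eq_of_subset)
        show "insert (y 1) (insert (y 0) (X - T - {x 0})) \<subseteq> N (insert (y 0) (X - T))"
          using e(2) N.mono[of "X - T" "insert (y 0) (X - T)"] N.ext[of "insert (y 0) (X - T)"] by blast
        show "insert (y 0) (X - T) \<subseteq> N (insert (y 1) (insert (y 0) (X - T - {x 0})))"
          using e(1) N.mono[of "insert (y 1) (X - T - {x 0})" "insert (y 1) (insert (y 0) (X - T - {x 0}))"]
            N.ext[of "insert (y 1) (insert (y 0) (X - T - {x 0}))"] by blast
      qed
    qed
    moreover have "X' \<subseteq> X \<union> y ` {..k}"
    proof -
      have "y' ` {..k - 1} \<subseteq> y ` {..k}" using main by (auto simp: y'_def)
      moreover have "X1 \<subseteq> X \<union> y ` {..k}" by (auto simp: X1_def)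
      ultimately show ?thesis using X'(1) by blast
    qed
    ultimately show ?thesis using X' yk by (intro exI[of _ X']) (auto simp: y'_def)
  qed
qed

end

section \<open>Waves and hindrances\<close>

text \<open>\<open>X\<close> is the witness. \<open>I\<close> is contracted explicitly in
  \<open>M\<close> only: for \<open>I \<subseteq> E\<close> it lies in \<open>E - W\<close>, which
  is contracted in \<open>N\<close> anyway.\<close>

definition wave ::
    "'a set \<Rightarrow> ('a set \<Rightarrow> 'a set) \<Rightarrow> ('a set \<Rightarrow> 'a set) \<Rightarrow> 'a set \<Rightarrow> 'a set \<Rightarrow> 'a set \<Rightarrow> bool" where
  "wave E M N I W X \<longleftrightarrow> W \<subseteq> E \<and> W \<inter> I = {} \<and> X \<subseteq> W \<and> W \<subseteq> M (I \<union> X) \<and>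
     indep_wrt (\<lambda>A. N (A \<union> (E - W))) X"

definition unhindered where
  "unhindered E M N I \<longleftrightarrow> (\<forall>W X. wave E M N I W X \<longrightarrow> W \<subseteq> N (X \<union> (E - W)))"

text \<open>The loops of \<open>M / I\<close> outside \<open>I\<close> always form a wave with empty
  witness, so the best one can hope for is that waves contain nothing but such loops.\<close>

definition loose where
  "loose E M N I \<longleftrightarrow> (\<forall>W X. wave E M N I W X \<longrightarrow> W \<subseteq> M I)"

lemma (in closure_matroid) indep_over_antimono:
  assumes "indep_wrt (\<lambda>A. cl (A \<union> Q)) X" "X' \<subseteq> X" "Q' \<subseteq> Q"
  shows "indep_wrt (\<lambda>A. cl (A \<union> Q')) X'"
  unfolding indep_wrt_def
proof (intro ballI notI)
  fix x assume x: "x \<in> X'" "x \<in> cl (X' - {x} \<union> Q')"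
  have "x \<in> cl (X - {x} \<union> Q)" by (rule in_mono[OF x(2)]) (use assms in blast)
  then show False using assms x by (auto simp: indep_wrt_def)
qed

lemma (in closure_matroid) indep_overD:
  assumes "indep_wrt (\<lambda>A. cl (A \<union> Q)) X" "x \<in> X" "x \<in> cl B" "B \<subseteq> X - {x} \<union> Q"
  shows False
  using assms(1,2) in_mono[OF assms(3,4)] by (simp add: indep_wrt_def)

context closure_pair
begin

text \<open>\<open>X1\<close> is \<open>N\<close>-independent over \<open>E - W1\<close>, which
  contains both \<open>X2 - W1\<close> and the complement of the union; by
  \<open>over_not_in\<close> it spans nothing new there. Since \<open>W2\<close> may use
  \<open>X1\<close> in \<open>M\<close>, sets that become waves only after the first wave has been
  absorbed can be glued on as well.\<close>

lemma wave_combine: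
  assumes w: "wave E M N I W1 X1" and W2: "W2 \<subseteq> E" "W2 \<inter> I = {}" "X2 \<subseteq> W2"
    "W2 \<subseteq> M (I \<union> X1 \<union> X2)" and i2: "indep_wrt (\<lambda>A. N (A \<union> (E - W2))) X2"
  shows "wave E M N I (W1 \<union> W2) (X1 \<union> (X2 - W1))"
proof -
  have w1: "W1 \<subseteq> E" "W1 \<inter> I = {}" "X1 \<subseteq> W1" "W1 \<subseteq> M (I \<union> X1)" "indep_wrt (\<lambda>A. N (A \<union> (E - W1))) X1"
    using w by (auto simp: wave_def)
  let ?X = "X1 \<union> (X2 - W1)"
  have m1: "W1 \<subseteq> M (I \<union> ?X)" using w1(4) M.mono[of "I \<union> X1" "I \<union> ?X"] by blast
  have "I \<union> X1 \<union> X2 \<subseteq> M (I \<union> ?X)" using m1 M.ext[of "I \<union> ?X"] by blast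
  then have "W2 \<subseteq> M (I \<union> ?X)" using W2(4) M.least[of "I \<union> X1 \<union> X2"] by blast
  moreover have "indep_wrt (\<lambda>A. N (A \<union> (E - (W1 \<union> W2)))) ?X"
    unfolding indep_wrt_def
  proof (intro ballI notI)
    fix x assume x: "x \<in> ?X" "x \<in> N (?X - {x} \<union> (E - (W1 \<union> W2)))"
    show False
    proof (cases "x \<in> X1")
      case True
      then show False using N.indep_overD[OF w1(5) True x(2)] W2 by blast
    next
      case False
      let ?T = "(X2 - W1) - {x} \<union> (E - (W1 \<union> W2))"
      have "x \<notin> N ?T"
        using N.indep_overD[OF i2, of x ?T] x(1) False by blast
      then have "x \<notin> N (?T \<union> X1)"
        using N.over_not_in[OF w1(5), of ?T x] x(1) False W2 by blast
      moreover have "?X - {x} \<union> (E - (W1 \<union> W2)) \<subseteq> ?T \<union> X1" by blast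
      ultimately show False using N.in_mono[OF x(2)] by blast
    qed
  qed
  ultimately show ?thesis using w1 W2 m1 unfolding wave_def by blast
qed

text \<open>By countability, countably many waves cover every element that lies in some wave. They
  are glued one after the other, and the union of the resulting chain is again a wave, whatever the
  circuits of \<open>N\<close>.\<close>

lemma wave_max:
  assumes "countable E"
  shows "\<exists>W X. wave E M N I W X \<and> (\<forall>W' X'. wave E M N I W' X' \<longrightarrow> W' \<subseteq> W)"
proof -
  have e: "wave E M N I {} {}" by (simp add: wave_def indep_wrt_def)
  define P where "P = {w. \<exists>W X. wave E M N I W X \<and> w \<in> W}"
  have PE: "P \<subseteq> E" by (auto simp: P_def wave_def)
  then have cP: "countable P" using assms countable_subset by blast
  have "\<exists>W X. wave E M N I W X \<and> (w \<in> P \<longrightarrow> w \<in> W)" for w using e by (auto simp: P_def)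
  then obtain wW wX where wv: "\<And>w. wave E M N I (wW w) (wX w)" "\<And>w. w \<in> P \<Longrightarrow> w \<in> wW w" by metis
  define W where "W n = wW (from_nat_into P n)" for n
  define X where "X n = wX (from_nat_into P n)" for n
  have wn: "wave E M N I (W n) (X n)" for n using wv by (simp add: W_def X_def)
  define WW where "WW n = (\<Union>j<n. W j)" for n
  define XX where "XX n = (\<Union>j<n. X j - WW j)" for n
  have ww: "wave E M N I (WW n) (XX n)" for n
  proof (induction n)
    case 0
    then show ?case using e by (simp add: WW_def XX_def)
  next
    case (Suc n)
    have "W n \<subseteq> M (I \<union> X n)" using wn[of n] by (simp add: wave_def)
    then have "W n \<subseteq> M (I \<union> XX n \<union> X n)" using M.mono[of "I \<union> X n" "I \<union> XX n \<union> X n"] by blast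
    then have "wave E M N I (WW n \<union> W n) (XX n \<union> (X n - WW n))"
      using wave_combine[OF Suc, of "W n" "X n"] wn[of n] by (simp add: wave_def)
    moreover have "WW (Suc n) = WW n \<union> W n" "XX (Suc n) = XX n \<union> (X n - WW n)"
      by (auto simp: WW_def XX_def lessThan_Suc)
    ultimately show ?case by simp
  qed
  have sub: "\<And>n. WW n \<subseteq> E" "\<And>n. WW n \<inter> I = {}" "\<And>n. XX n \<subseteq> WW n" "\<And>n. WW n \<subseteq> M (I \<union> XX n)"
    "\<And>n. indep_wrt (\<lambda>A. N (A \<union> (E - WW n))) (XX n)"
    using ww by (auto simp: wave_def)
  let ?W = "\<Union>n. WW n" and ?X = "\<Union>n. XX n"
  \<comment> \<open>The witness never changes on a region already covered. Hence a dependence over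
    the complement of the union is already a dependence at a single stage \<open>n\<close>.\<close>
  have XXmono: "XX n \<inter> WW m \<subseteq> XX m" for n m
  proof
    fix x assume x: "x \<in> XX n \<inter> WW m"
    then obtain j where "j < n" "x \<in> X j" "x \<notin> WW j" by (auto simp: XX_def)
    moreover from this x have "j < m" by (auto simp: WW_def)
    ultimately show "x \<in> XX m" by (auto simp: XX_def)
  qed
  have "wave E M N I ?W ?X"
    unfolding wave_def
  proof (intro conjI)
    show "?W \<subseteq> E" using sub(1) by blast
    show "?W \<inter> I = {}" using sub(2) by blast
    show "?X \<subseteq> ?W" using sub(3) by blast
    show "?W \<subseteq> M (I \<union> ?X)"
    proof
      fix w assume "w \<in> ?W"
      then obtain n where "w \<in> WW n" by blast
      then have "w \<in> M (I \<union> XX n)" using sub(4) by blast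
      then show "w \<in> M (I \<union> ?X)" by (rule M.in_mono) blast
    qed
    show "indep_wrt (\<lambda>A. N (A \<union> (E - ?W))) ?X"
      unfolding indep_wrt_def
    proof (intro ballI notI)
      fix x assume x: "x \<in> ?X" "x \<in> N (?X - {x} \<union> (E - ?W))"
      then obtain n where n: "x \<in> XX n" by blast
      have "?X - {x} \<union> (E - ?W) \<subseteq> XX n - {x} \<union> (E - WW n)"
        using XXmono[of _ n] sub(1,3) by blast
      then show False using N.indep_overD[OF sub(5) n x(2)] by blast
    qed
  qed
  moreover have "W' \<subseteq> ?W" if "wave E M N I W' X'" for W' X'
  proof
    fix w assume "w \<in> W'"
    then have wP: "w \<in> P" using that by (auto simp: P_def)
    then obtain n where n: "from_nat_into P n = w" using cP from_nat_into_surj by metis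
    then have "w \<in> W n" using wv(2)[OF wP] by (simp add: W_def)
    then show "w \<in> ?W" by (auto simp: WW_def intro!: exI[of _ "Suc n"])
  qed
  ultimately show ?thesis by blast
qed

lemma wave_shrink:
  assumes "wave E M N I W X" "indep_wrt M I"
  shows "\<exists>X'. X' \<subseteq> X \<and> wave E M N I W X' \<and> indep_wrt M (I \<union> X')"
proof -
  obtain B where B: "I \<subseteq> B" "B \<subseteq> I \<union> X" "indep_wrt M B" "I \<union> X \<subseteq> M B"
    using M.base[OF assms(2), of "I \<union> X"] by auto
  have X: "X \<subseteq> W" "W \<inter> I = {}" "W \<subseteq> M (I \<union> X)" "indep_wrt (\<lambda>A. N (A \<union> (E - W))) X" "W \<subseteq> E"
    using assms by (auto simp: wave_def)
  have e: "I \<union> (B - I) = B" using B by auto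
  have "W \<subseteq> M B" using X(3) M.least[OF B(4)] by blast
  moreover have "indep_wrt (\<lambda>A. N (A \<union> (E - W))) (B - I)"
    by (rule N.indep_over_antimono[OF X(4)]) (use B in auto)
  ultimately show ?thesis
    using X B e by (intro exI[of _ "B - I"]) (auto simp: wave_def)
qed

text \<open>Any wave relative to the enlarged set can be glued to the largest wave \<open>P\<close>,
  so it lies in \<open>P\<close> and is already spanned in \<open>M\<close>. The conclusions about
  \<open>P\<close> and \<open>I' \<inter> M I\<close> record where the new elements lie;
  \<open>augment_step\<close> needs this to recover independence in \<open>N\<close> and to keep old
  arcs alive.\<close>

lemma absorb:
  assumes E: "countable E" and IE: "I \<subseteq> E" and iM: "indep_wrt M I" and unh: "unhindered E M N I"
  shows "\<exists>I' P. I \<subseteq> I' \<and> I' \<subseteq> E \<and> I' \<inter> M I \<subseteq> I \<and> indep_wrt M I' \<and> unhindered E M N I' \<and> loose E M N I' \<and>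
    indep_wrt (\<lambda>A. N (A \<union> (E - P))) (I' - I) \<and> P \<subseteq> M I' \<and> P \<inter> I = {}"
proof -
  obtain P X0 where P0: "wave E M N I P X0" "\<And>W' X'. wave E M N I W' X' \<Longrightarrow> W' \<subseteq> P"
    using wave_max[OF E] by blast
  obtain X where X: "wave E M N I P X" "indep_wrt M (I \<union> X)"
    using wave_shrink[OF P0(1) iM] by blast
  have p: "P \<subseteq> E" "P \<inter> I = {}" "X \<subseteq> P" "P \<subseteq> M (I \<union> X)" "indep_wrt (\<lambda>A. N (A \<union> (E - P))) X"
    using X(1) by (auto simp: wave_def)
  let ?I = "I \<union> X"
  have comb: "wave E M N I (P \<union> W) (X \<union> (Y - P))" if w: "wave E M N ?I W Y" for W Y
    by (rule wave_combine[OF X(1)]) (use w in \<open>auto simp: wave_def\<close>)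
  have disj: "?I \<inter> M I \<subseteq> I"
  proof
    fix x assume x: "x \<in> ?I \<inter> M I"
    show "x \<in> I"
    proof (rule ccontr)
      assume "x \<notin> I"
      then have "x \<in> M (?I - {x})" using x M.mono[of I "?I - {x}"] by blast
      then show False using X(2) x by (auto simp: indep_wrt_def)
    qed
  qed
  have unh': "unhindered E M N ?I" unfolding unhindered_def
  proof (intro allI impI)
    fix W Y assume w: "wave E M N ?I W Y"
    have "P \<union> W \<subseteq> N (X \<union> (Y - P) \<union> (E - (P \<union> W)))"
      using unh comb[OF w] unfolding unhindered_def by blast
    moreover have "X \<union> (Y - P) \<union> (E - (P \<union> W)) \<subseteq> Y \<union> (E - W)"
      using w p by (auto simp: wave_def)
    ultimately show "W \<subseteq> N (Y \<union> (E - W))" using N.mono by blast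
  qed
  have loose': "loose E M N ?I" unfolding loose_def
  proof (intro allI impI)
    fix W Y assume w: "wave E M N ?I W Y"
    show "W \<subseteq> M ?I" using P0(2)[OF comb[OF w]] p(4) by blast
  qed
  have "?I - I = X" using p by auto
  then show ?thesis using p X IE disj unh' loose'
    by (intro exI[of _ ?I] exI[of _ P]) auto
qed

text \<open>Either the surplus element \<open>w0\<close> starts an augmentation, which turns \<open>insert c W\<close> into a wave, or the set
  reachable from the surplus elements is itself a hindrance not involving \<open>c\<close>.\<close>

lemma contract_not_hindered:
  assumes unh: "unhindered E M N I" and lo: "loose E M N I" and iM: "indep_wrt M I"
    and c: "c \<in> E" "c \<notin> M I" "c \<notin> W" and W: "W \<subseteq> E" "W \<inter> I = {}" "X0 \<subseteq> W" "W \<subseteq> M (insert c (I \<union> X0))"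
    and i0: "indep_wrt (\<lambda>A. N (A \<union> (E - W))) X0" and w0: "w0 \<in> W" "w0 \<notin> N (X0 \<union> (E - W))"
  shows False
proof -
  have "indep_wrt M (insert c I)" using M.indep_insert[OF iM c(2)] .
  then obtain B where B: "insert c I \<subseteq> B" "B \<subseteq> insert c (I \<union> X0)" "indep_wrt M B" "insert c (I \<union> X0) \<subseteq> M B"
    using M.base[of "insert c I" "insert c (I \<union> X0)"] by blast
  define X where "X = B - insert c I"
  have XX0: "X \<subseteq> X0" using B by (auto simp: X_def)
  have BX: "B = insert c (I \<union> X)" using B by (auto simp: X_def)
  have WX: "W \<subseteq> M (insert c (I \<union> X))" using W(4) M.least[OF B(4)] BX by blast
  have XW: "X \<subseteq> W" using XX0 W by blast
  have iX: "indep_wrt (\<lambda>A. N (A \<union> (E - W))) X" using N.indep_over_antimono[OF i0 XX0] by blast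
  have w0X: "w0 \<notin> N (X \<union> (E - W))" using w0(2) N.mono[of "X \<union> (E - W)" "X0 \<union> (E - W)"] XX0 by blast
  have cI: "c \<notin> I" using c M.in_ext by blast
  have nowave: False if "wave E M N I (insert c W) Y" for Y
    using lo that c unfolding loose_def by blast
  define M' where "M' = (\<lambda>A. M (A \<union> I))"
  define N' where "N' = (\<lambda>A. N (A \<union> (E - W)))"
  interpret M': closure_matroid M' unfolding M'_def by (rule M.contract)
  interpret N': closure_matroid N' unfolding N'_def by (rule N.contract)
  interpret P': closure_pair M' N' by unfold_locales
  have iN': "indep_wrt N' X" using iX by (simp add: N'_def)
  have iM': "indep_wrt M' X" unfolding M'_def indep_wrt_def
  proof (intro ballI notI)
    fix x assume x: "x \<in> X" "x \<in> M (X - {x} \<union> I)"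
    then have "X - {x} \<union> I \<subseteq> B - {x}" using B W XW by (auto simp: X_def)
    then have "x \<in> M (B - {x})" using M.in_mono[OF x(2)] by blast
    then show False using B x by (auto simp: indep_wrt_def X_def)
  qed
  have w0': "w0 \<notin> N' X" using w0X by (simp add: N'_def)
  define S where "S = W - N' X"
  define Y where "Y = alt_reach M' N' X W S"
  have YW: "Y \<subseteq> W" unfolding Y_def S_def using alt_reach_cases by fastforce
  show False
  proof (cases "Y \<subseteq> M' X")
    case False
    then obtain u where u: "u \<in> Y" "u \<notin> M' X" by blast
    obtain k y x where w: "alt_walk M' N' X k y x" "y k = u" "\<forall>i\<le>k. y i \<in> Y"
      using alt_reach_walk[of u M' N' X W S] u by (auto simp: Y_def S_def)
    have "\<exists>X'. X' \<subseteq> X \<union> y ` {..k} \<and> {} \<subseteq> X' \<and> y k \<in> X' \<and> indep_wrt M' X' \<and> indep_wrt N' X' \<and>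
        M' X' = M' (insert (y k) X) \<and> N' (X' - {}) = N' (insert (y 0) (X - {}))"
      by (rule P'.augment[OF iM' iN' _ w(1)]) (use u w(1,2) in \<open>auto simp: alt_walk_def\<close>)
    then obtain X' where X': "X' \<subseteq> X \<union> y ` {..k}" "indep_wrt N' X'" "M' X' = M' (insert u X)"
      using w by auto
    have X'W: "X' \<subseteq> W" using X'(1) w(3) YW XW by blast
    have uW: "u \<in> W" using u YW by blast
    \<comment> \<open>\<open>u\<close> is spanned with the help of \<open>c\<close> but not without
      it, so exchange makes \<open>u\<close> span \<open>c\<close>. The augmented set thus replaces
      everything for which \<open>c\<close> was used.\<close>
    have cu: "c \<in> M' (insert u X)"
      by (rule M'.exch) (use u uW WX in \<open>auto simp: M'_def Un_commute\<close>)
    have "insert c (I \<union> X) \<subseteq> M (insert u X \<union> I)"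
      using cu M.ext[of "insert u X \<union> I"] unfolding M'_def by blast
    then have "W \<subseteq> M' X'" using WX M.least[of "insert c (I \<union> X)"] X'(3) unfolding M'_def by blast
    moreover have "c \<in> M' X'" using cu X' by simp
    ultimately have "wave E M N I (insert c W) X'"
      unfolding wave_def
    proof (intro conjI)
      show "insert c W \<subseteq> E" "insert c W \<inter> I = {}" "X' \<subseteq> insert c W" using c W cI X'W by auto
      show "insert c W \<subseteq> M (I \<union> X')" using \<open>W \<subseteq> M' X'\<close> \<open>c \<in> M' X'\<close> by (simp add: M'_def Un_commute)
      show "indep_wrt (\<lambda>A. N (A \<union> (E - insert c W))) X'"
        using N.indep_over_antimono[of "E - W" X' X' "E - insert c W"] X'(2) by (auto simp: N'_def)
    qed
    then show False by (rule nowave)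
  next
    case sink: True
    define RX where "RX = {x\<in>X. \<exists>y\<in>Y. y \<notin> M' (X - {x})}"
    \<comment> \<open>An element of \<open>W\<close> outside \<open>X\<close> and \<open>Y\<close>
      has no fundamental circuit in \<open>N'\<close> through \<open>RX\<close>, else it would be
      reachable. So no member of \<open>RX\<close> is needed to span it, which makes
      \<open>RX\<close> independent over the complement of \<open>Y \<union> RX\<close>.\<close>
    have key: "v \<in> N' X \<and> (\<forall>x\<in>RX - {v}. v \<in> N' (X - {x}))" if v: "v \<in> RX \<union> (E - (Y \<union> RX))" for v
    proof (cases "v \<in> W \<and> v \<notin> X")
      case True
      then have vY: "v \<notin> Y" using v by (auto simp: RX_def)
      then have "v \<in> N' X" using True alt_reach.src[of v S M' N' X W] by (auto simp: Y_def S_def)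
      moreover have "v \<in> N' (X - {x})" if x: "x \<in> RX" for x
      proof (rule ccontr)
        assume n: "v \<notin> N' (X - {x})"
        obtain y where "y \<in> Y" "y \<notin> M' (X - {x})" "x \<in> X" using x by (auto simp: RX_def)
        then have "v \<in> Y" using alt_reach.step[of y M' N' X W S x v] sink True n \<open>v \<in> N' X\<close>
          by (auto simp: Y_def)
        then show False using vY by simp
      qed
      ultimately show ?thesis by blast
    next
      case False
      show ?thesis
      proof (cases "v \<in> X")
        case True
        then show ?thesis by (auto intro: N'.in_ext)
      next
        case False2: False
        then have "v \<in> E - W" using v False by (auto simp: RX_def)
        then have "v \<in> N' A" for A unfolding N'_def by (intro N.in_ext) blast
        then show ?thesis by blast
      qed
    qed
    have "wave E M N I (Y \<union> RX) RX"
      unfolding wave_def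
    proof (intro conjI)
      show "Y \<union> RX \<subseteq> E" "(Y \<union> RX) \<inter> I = {}" "RX \<subseteq> Y \<union> RX" using YW W XW by (auto simp: RX_def)
      have "Y \<subseteq> M' RX"
      proof
        fix y assume y: "y \<in> Y"
        have "y \<in> M' (X - (X - RX))"
          by (rule M'.removable[OF iM']) (use y sink in \<open>auto simp: RX_def\<close>)
        moreover have "X - (X - RX) = RX" by (auto simp: RX_def)
        ultimately show "y \<in> M' RX" by simp
      qed
      moreover have "RX \<subseteq> M' RX" by (rule M'.ext)
      ultimately show "Y \<union> RX \<subseteq> M (I \<union> RX)" by (simp add: M'_def Un_commute)
      show "indep_wrt (\<lambda>A. N (A \<union> (E - (Y \<union> RX)))) RX"
        unfolding indep_wrt_def
      proof (intro ballI notI)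
        fix x assume x: "x \<in> RX" "x \<in> N (RX - {x} \<union> (E - (Y \<union> RX)))"
        have "RX - {x} \<union> (E - (Y \<union> RX)) \<subseteq> N' (X - {x})" using key x(1) by blast
        then have "x \<in> N' (X - {x})" using N.in_trans[OF x(2)] unfolding N'_def by blast
        then show False using iN' x by (auto simp: indep_wrt_def RX_def)
      qed
    qed
    then have "Y \<union> RX \<subseteq> N (RX \<union> (E - (Y \<union> RX)))" using unh unfolding unhindered_def by blast
    moreover have "w0 \<in> Y" using w0(1) w0' by (auto simp: Y_def S_def intro: alt_reach.src)
    ultimately have w: "w0 \<in> N (RX \<union> (E - (Y \<union> RX)))" by blast
    have "RX \<union> (E - (Y \<union> RX)) \<subseteq> N' X" using key by blast
    then show False using N.in_trans[OF w] w0' unfolding N'_def by blast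
  qed
qed

end

section \<open>Spanning an element of the finitary part\<close>

text \<open>The two conditions say that \<open>N\<close> is the direct sum of its parts inside and
  outside \<open>U\<close>. Finiteness inside \<open>U\<close> is a separate hypothesis of
  \<open>key_lemma\<close>, so that the results on augmentation also apply to arbitrary
  \<open>N\<close> with \<open>U = UNIV\<close>.\<close>

locale split_pair = closure_pair M N for M N :: "'a set \<Rightarrow> 'a set" +
  fixes E U :: "'a set"
  assumes split_in: "x \<in> N A \<Longrightarrow> x \<in> U \<Longrightarrow> x \<in> N (A \<inter> U)"
    and split_out: "x \<in> N A \<Longrightarrow> x \<notin> U \<Longrightarrow> x \<in> N (A - U)"
begin

text \<open>Outside \<open>U\<close>, where \<open>N\<close> may have infinite circuits, independence and alternating paths are taken relative
  to the elements not yet spanned by \<open>I\<close> in \<open>M\<close>; inside \<open>U\<close> this makes no difference.\<close>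

definition outer_rest :: "'a set \<Rightarrow> 'a set" where
  "outer_rest I = E - M I - U"

definition N_rest :: "'a set \<Rightarrow> 'a set \<Rightarrow> 'a set" where
  "N_rest I A = N (A \<union> outer_rest I)"

definition good :: "'a set \<Rightarrow> bool" where
  "good I \<longleftrightarrow> I \<subseteq> E \<and> indep_wrt M I \<and> indep_wrt (N_rest I) I \<and> unhindered E M N I \<and> loose E M N I"

lemma N_rest_matroid: "closure_matroid (N_rest I)"
  using N.contract[of "outer_rest I"] by (simp add: N_rest_def[abs_def])

lemma N_rest_in_U: "y \<in> U \<Longrightarrow> y \<in> N_rest I A \<longleftrightarrow> y \<in> N A"
proof
  assume y: "y \<in> U" "y \<in> N_rest I A"
  then have "y \<in> N ((A \<union> outer_rest I) \<inter> U)" unfolding N_rest_def by (intro split_in)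
  then show "y \<in> N A" by (rule N.in_mono) (auto simp: outer_rest_def)
next
  assume "y \<in> N A"
  then show "y \<in> N_rest I A" unfolding N_rest_def by (rule N.in_mono) auto
qed

text \<open>The loops of \<open>M / I\<close> form a wave with empty witness, so unhinderedness lets
  the remaining elements of \<open>E\<close> span them in \<open>N\<close>. Outside \<open>U\<close>
  these remaining elements all belong to \<open>I\<close> or to \<open>outer_rest I\<close>.\<close>

lemma spanned_in_good:
  assumes g: "good I" and a: "a \<in> E" "a \<in> M I" "a \<notin> U"
  shows "a \<in> N_rest I I"
proof (cases "a \<in> I")
  case True
  then show ?thesis unfolding N_rest_def by (intro N.in_ext) auto
next
  case False
  let ?J = "E \<inter> M I - I"
  have "wave E M N I ?J {}" by (auto simp: wave_def indep_wrt_def)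
  then have "?J \<subseteq> N ({} \<union> (E - ?J))" using g unfolding good_def unhindered_def by blast
  then have "a \<in> N (E - ?J)" using a False by auto
  then have "a \<in> N (E - ?J - U)" by (rule split_out[OF _ a(3)])
  then show ?thesis unfolding N_rest_def by (rule N.in_mono) (auto simp: outer_rest_def)
qed

text \<open>In \<open>M\<close>, passing from \<open>I\<close> to \<open>I'\<close> has the effect
  of contracting the single element \<open>c\<close>. A hindrance relative to \<open>I'\<close> is
  therefore rebuilt as one that arises from contracting \<open>c\<close> over \<open>I\<close>, and
  \<open>contract_not_hindered\<close> excludes it.\<close>

lemma augment_unhindered:
  assumes g: "good I" and c: "c \<in> E" "c \<notin> M I" "c \<in> I'" and I': "I' \<subseteq> E" "M I' = M (insert c I)"
    and sp: "I \<subseteq> N_rest I I'"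
  shows "unhindered E M N I'"
  unfolding unhindered_def
proof (intro allI impI)
  fix W X assume w: "wave E M N I' W X"
  have W: "W \<subseteq> E" "W \<inter> I' = {}" "X \<subseteq> W" "W \<subseteq> M (I' \<union> X)" and iX: "indep_wrt (\<lambda>A. N (A \<union> (E - W))) X"
    using w by (auto simp: wave_def)
  have I: "I \<subseteq> E" "indep_wrt M I" "indep_wrt (N_rest I) I" "unhindered E M N I" "loose E M N I"
    using g by (auto simp: good_def)
  show "W \<subseteq> N (X \<union> (E - W))"
  proof (rule ccontr)
    assume "\<not> W \<subseteq> N (X \<union> (E - W))"
    then obtain w0 where w0: "w0 \<in> W" "w0 \<notin> N (X \<union> (E - W))" by blast
    define D where "D = E \<inter> M I"
    define G where "G = E - M I"
    \<comment> \<open>\<open>I\<close> and \<open>I'\<close> may differ inside the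
      \<open>M\<close>-span of \<open>I\<close>. In this region \<open>W\<close> is discarded and
      replaced by all of \<open>D - I\<close>, which \<open>I\<close> spans in \<open>M\<close> for
      free.\<close>
    define W' where "W' = (W - D) \<union> (D - I)"
    define X' where "X' = X - D"
    have ID: "I \<subseteq> D" using I(1) M.ext[of I] by (auto simp: D_def)
    have EW': "E - W' = I \<union> (G - W)" using ID by (auto simp: W'_def D_def G_def)
    have cW: "c \<notin> W'" using c W by (auto simp: W'_def D_def)
    have G0G: "outer_rest I = G - U" by (simp add: outer_rest_def G_def)
    have IU: "I \<inter> U \<subseteq> N (E - W)"
    proof
      fix x assume x: "x \<in> I \<inter> U"
      then have "x \<in> N I'" using sp N_rest_in_U[of x I I'] by blast
      then show "x \<in> N (E - W)" by (rule N.in_mono) (use I' W in auto)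
    qed
    have iI: "indep_wrt (\<lambda>A. N (A \<union> outer_rest I)) I" using I(3) by (simp add: N_rest_def[abs_def])
    have inU: "v \<in> N (X \<union> (E - W))" if v: "v \<in> N (X' \<union> (E - W'))" "v \<in> U" for v
    proof -
      have "v \<in> N ((X' \<union> (E - W')) \<inter> U)" using split_in v by blast
      moreover have "(X' \<union> (E - W')) \<inter> U \<subseteq> N (X \<union> (E - W))"
        using IU N.mono[of "E - W" "X \<union> (E - W)"] N.ext[of "X \<union> (E - W)"]
        by (auto simp: EW' X'_def G_def)
      ultimately show ?thesis by (rule N.in_trans)
    qed
    let ?T = "(X' \<union> (G - W)) - U"
    have TG: "?T \<subseteq> outer_rest I" unfolding G0G using W(1,3) by (auto simp: X'_def G_def D_def)
    \<comment> \<open>Outside \<open>U\<close>, the set \<open>I\<close> is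
      \<open>N\<close>-independent over \<open>outer_rest I\<close>, so it is of no help in spanning
      elements of \<open>outer_rest I\<close>.\<close>
    have outU: "v \<in> N (T - U)" if v: "v \<in> N (T \<union> I)" "v \<in> outer_rest I" "T - U \<subseteq> outer_rest I" for v T
    proof (rule ccontr)
      assume n: "v \<notin> N (T - U)"
      have "v \<notin> U" using v(2) by (simp add: outer_rest_def)
      then have "v \<in> N ((T \<union> I) - U)" using split_out v by blast
      then have "v \<in> N (T - U \<union> I)" by (rule N.in_mono) auto
      then show False using N.over_not_in[OF iI v(3) v(2) n] by blast
    qed
    \<comment> \<open>The surplus element need not stay at \<open>w0\<close>: outside
      \<open>U\<close> it may move to some \<open>v\<close> in \<open>outer_rest I\<close>. If there
      is no such \<open>v\<close>, then \<open>X\<close> and \<open>E - W\<close> together span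
      \<open>outer_rest I\<close> and \<open>I'\<close>, hence also \<open>w0\<close>.\<close>
    have "\<exists>w\<in>W'. w \<notin> N (X' \<union> (E - W'))"
    proof (cases "w0 \<in> U")
      case True
      have "w0 \<notin> I"
      proof
        assume "w0 \<in> I"
        then have "w0 \<in> N (E - W)" using IU True by blast
        then show False using w0 N.mono[of "E - W" "X \<union> (E - W)"] by blast
      qed
      then have "w0 \<in> W'" using w0 by (auto simp: W'_def)
      then show ?thesis using inU[of w0] True w0 by blast
    next
      case False
      show ?thesis
      proof (cases "\<exists>v\<in>W \<inter> outer_rest I. v \<notin> N ?T")
        case True
        then obtain v where v: "v \<in> W" "v \<in> outer_rest I" "v \<notin> N ?T" by blast
        have "v \<notin> N (X' \<union> (E - W'))"
        proof
          assume "v \<in> N (X' \<union> (E - W'))"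
          moreover have "X' \<union> (E - W') = (X' \<union> (G - W)) \<union> I" by (auto simp: EW')
          ultimately show False using outU[of v "X' \<union> (G - W)"] v TG by simp
        qed
        moreover have "v \<in> W'" using v by (auto simp: W'_def outer_rest_def D_def)
        ultimately show ?thesis by blast
      next
        case no: False
        have TX: "?T \<subseteq> X \<union> (E - W)" by (auto simp: X'_def G_def)
        have G0N: "outer_rest I \<subseteq> N (X \<union> (E - W))"
        proof
          fix v assume v: "v \<in> outer_rest I"
          show "v \<in> N (X \<union> (E - W))"
          proof (cases "v \<in> W")
            case True
            then have "v \<in> N ?T" using no v by blast
            then show ?thesis using TX by (rule N.in_mono)
          next
            case False
            then show ?thesis using v by (intro N.in_ext) (auto simp: outer_rest_def)
          qed
        qed
        have I'N: "I' \<subseteq> N (X \<union> (E - W))" using I' W N.ext[of "X \<union> (E - W)"] by blast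
        have "w0 \<notin> outer_rest I" using G0N w0 by blast
        then have "w0 \<in> M I" "w0 \<in> E" using False w0 W by (auto simp: outer_rest_def)
        then have "w0 \<in> N_rest I I" using spanned_in_good[OF g] False by blast
        moreover interpret N_rest: closure_matroid "N_rest I" by (rule N_rest_matroid)
        have "N_rest I I \<subseteq> N_rest I I'" using N_rest.least[OF sp] .
        ultimately have "w0 \<in> N (I' \<union> outer_rest I)" unfolding N_rest_def by blast
        moreover have "I' \<union> outer_rest I \<subseteq> N (X \<union> (E - W))" using G0N I'N by blast
        ultimately have "w0 \<in> N (X \<union> (E - W))" by (rule N.in_trans)
        then show ?thesis using w0 by blast
      qed
    qed
    then obtain w1 where w1: "w1 \<in> W'" "w1 \<notin> N (X' \<union> (E - W'))" by blast
    show False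
    proof (rule contract_not_hindered[OF I(4,5,2) c(1,2) cW _ _ _ _ _ w1])
      show "W' \<subseteq> E" "W' \<inter> I = {}" "X' \<subseteq> W'" using W ID by (auto simp: W'_def X'_def D_def)
      have DM: "D \<subseteq> M (insert c (I \<union> X'))"
        using M.mono[of I "insert c (I \<union> X')"] by (auto simp: D_def)
      have "I' \<subseteq> M (insert c (I \<union> X'))"
        using M.ext[of I'] I'(2) M.mono[of "insert c I" "insert c (I \<union> X')"] by blast
      then have "I' \<union> X \<subseteq> M (insert c (I \<union> X'))"
        using DM M.ext[of "insert c (I \<union> X')"] by (auto simp: X'_def)
      then have "W \<subseteq> M (insert c (I \<union> X'))" using W(4) M.least[of "I' \<union> X"] by blast
      then show "W' \<subseteq> M (insert c (I \<union> X'))" using DM by (auto simp: W'_def)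
      show "indep_wrt (\<lambda>A. N (A \<union> (E - W'))) X'"
        unfolding indep_wrt_def
      proof (intro ballI notI)
        fix x assume x: "x \<in> X'" "x \<in> N (X' - {x} \<union> (E - W'))"
        have xX: "x \<in> X" using x by (auto simp: X'_def)
        show False
        proof (cases "x \<in> U")
          case True
          then have "x \<in> N ((X' - {x} \<union> (E - W')) \<inter> U)" using split_in x by blast
          moreover have "(X' - {x} \<union> (E - W')) \<inter> U \<subseteq> N (X - {x} \<union> (E - W))"
            using IU N.mono[of "E - W" "X - {x} \<union> (E - W)"] N.ext[of "X - {x} \<union> (E - W)"]
            by (auto simp: EW' X'_def G_def)
          ultimately have "x \<in> N (X - {x} \<union> (E - W))" by (rule N.in_trans)
          then show False using N.indep_overD[OF iX xX] by blast
        next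
          case False
          then have xG: "x \<in> outer_rest I" using x W by (auto simp: X'_def D_def outer_rest_def)
          have "X' - {x} \<union> (E - W') = (X' - {x} \<union> (G - W)) \<union> I" by (auto simp: EW')
          then have "x \<in> N ((X' - {x} \<union> (G - W)) - U)"
            using outU[of x "X' - {x} \<union> (G - W)"] x(2) xG TG by auto
          then show False using N.indep_overD[OF iX xX] by (auto simp: X'_def G_def)
        qed
      qed
    qed
  qed
qed

text \<open>In the application \<open>f\<close> may be a deleted element outside \<open>E\<close>.
  Walks therefore start at the elements of \<open>E\<close> that are parallel to \<open>f\<close> in
  \<open>N / I\<close>; adding one of them to \<open>I\<close> makes \<open>f\<close>
  spanned.\<close>

definition sources where
  "sources I f = {y \<in> E \<inter> U. y \<in> N (insert f I) \<and> y \<notin> N I}"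

definition reach_out where
  "reach_out I f = alt_reach M (N_rest I) I E (sources I f)"

definition reach_in where
  "reach_in I f = {x \<in> I. \<exists>y\<in>reach_out I f. y \<notin> M (I - {x})}"

lemma reach_out_notin: "y \<in> reach_out I f \<Longrightarrow> y \<in> E \<and> y \<notin> I"
  unfolding reach_out_def using alt_reach_cases[of y M "N_rest I" I E "sources I f"] N.in_ext[of y I]
  by (auto simp: sources_def)

lemma reach_out_step:
  assumes "x \<in> reach_in I f" "reach_out I f \<subseteq> M I" "y \<in> E" "y \<notin> I" "y \<in> N_rest I I" "y \<notin> N_rest I (I - {x})"
  shows "y \<in> reach_out I f"
proof -
  obtain y0 where "y0 \<in> reach_out I f" "y0 \<notin> M (I - {x})" "x \<in> I" using assms(1) by (auto simp: reach_in_def)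
  then show ?thesis using assms alt_reach.step[of y0 M "N_rest I" I E "sources I f" x y] by (auto simp: reach_out_def)
qed

lemma reach_out_span:
  assumes "indep_wrt M I" "reach_out I f \<subseteq> M I" "y \<in> reach_out I f"
  shows "y \<in> M (reach_in I f)"
proof -
  have "y \<in> M (I - (I - reach_in I f))"
    by (rule M.removable[OF assms(1)]) (use assms in \<open>auto simp: reach_in_def\<close>)
  moreover have "I - (I - reach_in I f) = reach_in I f" by (auto simp: reach_in_def)
  ultimately show ?thesis by simp
qed

text \<open>The elements reachable from a non-augmentable \<open>h\<close> are kept fixed by the augmentation for \<open>f\<close>: a path that
  meets them could be continued from \<open>h\<close>.\<close>

lemma augment_step:
  assumes E: "countable E" and g: "good I" and f: "f \<in> U" "\<not> reach_out I f \<subseteq> M I"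
  shows "\<exists>I'. good I' \<and> f \<in> N I' \<and> N I \<inter> U \<subseteq> N I' \<and>
    (\<forall>h\<in>U. h \<notin> N I' \<longrightarrow> reach_out I h \<subseteq> M I \<longrightarrow> reach_out I h \<subseteq> reach_out I' h \<and> reach_in I h \<subseteq> reach_in I' h)"
proof -
  have I: "I \<subseteq> E" "indep_wrt M I" "indep_wrt (N_rest I) I" "unhindered E M N I" "loose E M N I"
    using g by (auto simp: good_def)
  interpret N_rest: closure_matroid "N_rest I" by (rule N_rest_matroid)
  interpret P2: closure_pair M "N_rest I" by unfold_locales
  define FR where "FR = {h. reach_out I h \<subseteq> M I}"
  define T where "T = (\<Union>h\<in>FR. reach_in I h)"
  define YY where "YY = (\<Union>h\<in>FR. reach_out I h)"
  have TI: "T \<subseteq> I" by (auto simp: T_def reach_in_def)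
  have YM: "YY \<subseteq> M I" by (auto simp: YY_def FR_def)
  have YE: "YY \<inter> I = {}" using reach_out_notin by (auto simp: YY_def)
  have Tstep: "y \<in> YY" if "x \<in> T" "y \<in> E" "y \<notin> I" "y \<in> N_rest I I" "y \<notin> N_rest I (I - {x})" for x y
    using that reach_out_step[of x I _ y] by (auto simp: T_def YY_def FR_def)
  have YT: "x \<in> T" if "y \<in> YY" "x \<in> I" "y \<notin> M (I - {x})" for x y
    using that by (auto simp: YY_def T_def reach_in_def)
  obtain c where c: "c \<in> reach_out I f" "c \<notin> M I" using f by blast
  have "sources I f \<inter> N_rest I I = {}" using N_rest_in_U by (auto simp: sources_def)
  then obtain k y x where w: "alt_walk M (N_rest I) I k y x" "y 0 \<in> sources I f" "y k = c" "\<forall>i\<le>k. y i \<in> reach_out I f"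
    using alt_reach_walk[of c M "N_rest I" I E "sources I f"] c by (auto simp: reach_out_def)
  have wi: "x i \<in> I" "y i \<in> M I" "y i \<notin> M (I - {x i})" "y (Suc i) \<notin> I" "y (Suc i) \<in> N_rest I I"
      "y (Suc i) \<notin> N_rest I (I - {x i})" if "i < k" for i
    using w(1) that by (auto simp: alt_walk_def)
  have yE: "y i \<in> E" if "i \<le> k" for i using w(4) reach_out_notin that by blast
  \<comment> \<open>Once in \<open>YY\<close>, the walk stays in \<open>YY\<close> and hence in
    \<open>M I\<close>, whereas its end \<open>c\<close> lies outside \<open>M I\<close>.\<close>
  have yY: "y i \<notin> YY" if "i \<le> k" for i
  proof
    assume "y i \<in> YY"
    have "y j \<in> YY" if "i \<le> j" "j \<le> k" for j
      using that
    proof (induction j rule: dec_induct)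
      case base
      show ?case by (rule \<open>y i \<in> YY\<close>)
    next
      case (step j)
      then have "x j \<in> T" using YT[of "y j" "x j"] wi[of j] by auto
      then show ?case using Tstep[of "x j" "y (Suc j)"] wi[of j] yE[of "Suc j"] step by auto
    qed
    then show False using that YM c w(3) by blast
  qed
  have xT: "x i \<notin> T" if "i < k" for i
    using Tstep[of "x i" "y (Suc i)"] wi[OF that] yE[of "Suc i"] yY[of "Suc i"] that by auto
  \<comment> \<open>No arc leads from \<open>T\<close> to a vertex outside \<open>YY\<close>, so
    each element of \<open>T\<close> can be dispensed with singly, and by \<open>removable\<close>
    all of them together.\<close>
  have yT: "y (Suc i) \<in> N_rest I (I - T)" if "i < k" for i
  proof (rule N_rest.removable[OF I(3) wi(5)[OF that] TI])
    fix t assume t: "t \<in> T"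
    have "y (Suc i) \<in> E" "y (Suc i) \<notin> YY" using yE yY that by auto
    then show "y (Suc i) \<in> N_rest I (I - {t})" using Tstep[OF t] wi(4,5)[OF that] by blast
  qed
  have "\<exists>X'. X' \<subseteq> I \<union> y ` {..k} \<and> T \<subseteq> X' \<and> y k \<in> X' \<and> indep_wrt M X' \<and> indep_wrt (N_rest I) X' \<and>
      M X' = M (insert (y k) I) \<and> N_rest I (X' - T) = N_rest I (insert (y 0) (I - T))"
    by (rule P2.augment[OF I(2,3) TI w(1)]) (use c w(3) xT yT in auto)
  then obtain S where S: "S \<subseteq> I \<union> y ` {..k}" "T \<subseteq> S" "c \<in> S" "indep_wrt M S" "indep_wrt (N_rest I) S"
      "M S = M (insert c I)" "N_rest I (S - T) = N_rest I (insert (y 0) (I - T))"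
    using w(3) by blast
  have SE: "S \<subseteq> E" using S(1) I(1) yE by blast
  have SY: "S \<inter> YY = {}" using S(1) YE yY by blast
  have sp: "insert (y 0) (I - T) \<subseteq> N_rest I (S - T)" using S(7) N_rest.ext[of "insert (y 0) (I - T)"] by simp
  have spI: "insert (y 0) I \<subseteq> N_rest I S"
    using sp N_rest.mono[of "S - T" S] S(2) N_rest.ext[of S] by blast
  have "unhindered E M N S"
    by (rule augment_unhindered[OF g _ c(2) S(3) SE S(6)]) (use c reach_out_notin spI in auto)
  then obtain I' P where I': "S \<subseteq> I'" "I' \<subseteq> E" "I' \<inter> M S \<subseteq> S" "indep_wrt M I'" "unhindered E M N I'"
      "loose E M N I'" "indep_wrt (\<lambda>A. N (A \<union> (E - P))) (I' - S)" "P \<subseteq> M I'" "P \<inter> S = {}"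
    using absorb[OF E SE S(4)] by blast
  have MM: "M I \<subseteq> M S" using S(6) M.mono[of I "insert c I"] by auto
  have MM': "M S \<subseteq> M I'" using M.mono[OF I'(1)] .
  have GG: "outer_rest I' \<subseteq> outer_rest I" using MM MM' by (auto simp: outer_rest_def)
  interpret K: closure_matroid "N_rest I'" by (rule N_rest_matroid)
  \<comment> \<open>\<open>S\<close> stays independent because \<open>outer_rest\<close> shrinks.
    The elements added by \<open>absorb\<close> are independent over everything outside
    \<open>P\<close>, and both \<open>S\<close> and \<open>outer_rest I'\<close> avoid
    \<open>P\<close>.\<close>
  have iK: "indep_wrt (N_rest I') I'"
  proof -
    have "indep_wrt (\<lambda>A. N (A \<union> outer_rest I)) S" using S(5) by (simp add: N_rest_def[abs_def])
    then have "indep_wrt (N_rest I') S"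
      using N.indep_over_antimono[OF _ order_refl GG] by (simp add: N_rest_def[abs_def])
    moreover have "S \<union> outer_rest I' \<subseteq> E - P" using SE I'(8,9) by (auto simp: outer_rest_def)
    then have "indep_wrt (\<lambda>A. N (A \<union> (S \<union> outer_rest I'))) (I' - S)"
      using N.indep_over_antimono[OF I'(7) order_refl] by blast
    then have "indep_wrt (\<lambda>A. N_rest I' (A \<union> S)) (I' - S)" by (simp add: N_rest_def Un_assoc)
    ultimately have "indep_wrt (N_rest I') ((I' - S) \<union> S)" using K.indep_Un by blast
    moreover have "(I' - S) \<union> S = I'" using I' by auto
    ultimately show ?thesis by simp
  qed
  have g': "good I'" using I' iK by (simp add: good_def)
  have IU: "insert (y 0) I \<inter> U \<subseteq> N I'"
  proof
    fix v assume v: "v \<in> insert (y 0) I \<inter> U"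
    then have "v \<in> N S" using spI N_rest_in_U[of v I S] by blast
    then show "v \<in> N I'" using I'(1) by (rule N.in_mono)
  qed
  have NU: "v \<in> N I'" if v: "v \<in> N A" "v \<in> U" "A \<inter> U \<subseteq> N I'" for v A
    using N.in_trans[OF split_in[OF v(1,2)] v(3)] .
  have fI: "f \<in> N I'"
  proof (rule NU[OF _ f(1) IU])
    show "f \<in> N (insert (y 0) I)" by (rule N.exch) (use w(2) in \<open>auto simp: sources_def\<close>)
  qed
  have IU': "I \<inter> U \<subseteq> N I'" using IU by blast
  have NIU: "N I \<inter> U \<subseteq> N I'" using NU[OF _ _ IU'] by blast
  have YI': "YY \<inter> I' = {}" using I'(3) YM MM SY by blast
  have TI': "T \<subseteq> I'" using S(2) I'(1) by blast
  have Medge: "y \<notin> M (I' - {x})" if yx: "y \<in> YY" "x \<in> I" "y \<notin> M (I - {x})" for x y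
  proof
    assume y: "y \<in> M (I' - {x})"
    have xT: "x \<in> T" using YT yx by blast
    obtain h where "h \<in> FR" "y \<in> reach_out I h" using yx(1) by (auto simp: YY_def)
    then have "y \<in> M (reach_in I h)" using reach_out_span[OF I(2)] by (auto simp: FR_def)
    then have yT: "y \<in> M T" by (rule M.in_mono) (use \<open>h \<in> FR\<close> in \<open>auto simp: T_def\<close>)
    have "y \<notin> M (T - {x})" using yx(3) M.mono[of "T - {x}" "I - {x}"] TI by blast
    then have "x \<in> M (insert y (T - {x}))" using M.exchange_span(1) yT by blast
    moreover have "insert y (T - {x}) \<subseteq> M (I' - {x})" using y TI' M.ext[of "I' - {x}"] by blast
    ultimately have "x \<in> M (I' - {x})" by (rule M.in_trans)
    then show False using I'(4) xT TI' by (auto simp: indep_wrt_def)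
  qed
  \<comment> \<open>The remaining members of \<open>T\<close> are still present, and
    \<open>I - T\<close> is spanned by \<open>S - T\<close> in \<open>N_rest I\<close>. So if
    \<open>y'\<close> were spanned without \<open>x\<close>, exchange would make \<open>x\<close>
    spanned by the other elements, against independence.\<close>
  have Nedge: "y' \<in> N_rest I' I' \<and> y' \<notin> N_rest I' (I' - {x})"
    if x: "x \<in> T" and y': "y' \<in> E" "y' \<notin> I" "y' \<in> N_rest I I" "y' \<notin> N_rest I (I - {x})" for x y'
  proof
    have yY: "y' \<in> YY" using Tstep that by blast
    show "y' \<in> N_rest I' I'"
    proof (cases "y' \<in> U")
      case True
      then show ?thesis using N_rest_in_U y'(3) NIU by blast
    next
      case False
      then show ?thesis using spanned_in_good[OF g'] y'(1) YM MM MM' yY by blast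
    qed
    have xy: "x \<in> N_rest I (insert y' (I - {x}))" using N_rest.exchange_span(1)[OF y'(3,4)] .
    have IS: "I - {x} \<subseteq> N_rest I (S - {x})"
    proof -
      have "T - {x} \<subseteq> N_rest I (S - {x})" using S(2) N_rest.ext[of "S - {x}"] by blast
      moreover have "I - T \<subseteq> N_rest I (S - {x})" using sp N_rest.mono[of "S - T" "S - {x}"] x by blast
      ultimately show ?thesis by blast
    qed
    show "y' \<notin> N_rest I' (I' - {x})"
    proof
      assume y: "y' \<in> N_rest I' (I' - {x})"
      have xI': "x \<in> I'" using x TI' by blast
      show False
      proof (cases "y' \<in> U")
        case True
        have xU: "x \<in> U"
        proof (rule ccontr)
          assume "x \<notin> U"
          then have "x \<in> N (insert y' (I - {x}) \<union> outer_rest I - U)" using split_out xy unfolding N_rest_def by blast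
          then have "x \<in> N_rest I (I - {x})" unfolding N_rest_def by (rule N.in_mono) (use True in auto)
          then show False using I(3) x TI by (auto simp: indep_wrt_def)
        qed
        have "x \<in> N (insert y' (I - {x}))" using xy xU N_rest_in_U by blast
        then have "x \<in> N (insert y' (I - {x}) \<inter> U)" using split_in xU by blast
        moreover have "insert y' (I - {x}) \<inter> U \<subseteq> N (I' - {x})"
        proof
          fix v assume v: "v \<in> insert y' (I - {x}) \<inter> U"
          show "v \<in> N (I' - {x})"
          proof (cases "v = y'")
            case True
            then show ?thesis using y v N_rest_in_U by blast
          next
            case False
            then have "v \<in> N_rest I (S - {x})" using v IS by blast
            then have "v \<in> N (S - {x})" using v N_rest_in_U by blast
            then show ?thesis by (rule N.in_mono) (use I'(1) in auto)
          qed
        qed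
        ultimately have "x \<in> N (I' - {x})" by (rule N.in_trans)
        then have "x \<in> N_rest I' (I' - {x})" using N_rest_in_U xU by blast
        then show False using iK xI' by (auto simp: indep_wrt_def)
      next
        case False
        then have "y' \<in> N (I' - {x} \<union> outer_rest I' - U)" using split_out y unfolding N_rest_def by blast
        \<comment> \<open>An element of \<open>I'\<close> outside \<open>S\<close> lies outside
          \<open>M S\<close>, hence outside \<open>M I\<close>. If it is also outside
          \<open>U\<close>, it belongs to \<open>outer_rest I\<close>, over which \<open>S\<close>
          is independent.\<close>
        moreover have "I' - {x} \<union> outer_rest I' - U \<subseteq> (S - {x}) \<union> outer_rest I"
        proof
          fix v assume v: "v \<in> I' - {x} \<union> outer_rest I' - U"
          show "v \<in> (S - {x}) \<union> outer_rest I"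
          proof (cases "v \<in> outer_rest I'")
            case True
            then show ?thesis using GG by blast
          next
            case False
            then have "v \<in> I'" "v \<noteq> x" "v \<notin> U" using v by auto
            then show ?thesis using I'(2,3) MM by (auto simp: outer_rest_def)
          qed
        qed
        ultimately have "y' \<in> N_rest I (S - {x})" unfolding N_rest_def by (rule N.in_mono)
        then have "insert y' (I - {x}) \<subseteq> N_rest I (S - {x})" using IS by blast
        with xy have "x \<in> N_rest I (S - {x})" by (rule N_rest.in_trans)
        then show False using S(2,5) x by (auto simp: indep_wrt_def)
      qed
    qed
  qed
  have "reach_out I h \<subseteq> reach_out I' h \<and> reach_in I h \<subseteq> reach_in I' h" if h: "h \<in> U" "h \<notin> N I'" "reach_out I h \<subseteq> M I" for h
  proof -
    have hF: "h \<in> FR" using h by (simp add: FR_def)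
    have RYY: "reach_out I h \<subseteq> YY" using hF by (auto simp: YY_def)
    have RXT: "reach_in I h \<subseteq> T" using hF by (auto simp: T_def)
    have mono: "y \<in> reach_out I' h" if "y \<in> reach_out I h" for y
      using that unfolding reach_out_def[of I h]
    proof (induction rule: alt_reach.induct)
      case (src y)
      then have y: "y \<in> E" "y \<in> U" "y \<in> N (insert h I)" "y \<notin> N I" by (auto simp: sources_def)
      have "y \<in> N (insert h I \<inter> U)" using split_in y by blast
      moreover have "insert h I \<inter> U \<subseteq> N (insert h I')"
        using IU' N.mono[of I' "insert h I'"] N.ext[of "insert h I'"] by blast
      ultimately have "y \<in> N (insert h I')" by (rule N.in_trans)
      moreover have "y \<notin> N I'"
      proof
        assume yI: "y \<in> N I'"
        have "h \<in> N (insert y I)" using y(3,4) by (rule N.exch)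
        then have "h \<in> N I'" by (rule NU[OF _ h(1)]) (use IU' yI in auto)
        then show False using h by simp
      qed
      ultimately have "y \<in> sources I' h" using y by (simp add: sources_def)
      then show ?case unfolding reach_out_def by (rule alt_reach.src)
    next
      case (step y x y')
      have yR: "y \<in> reach_out I h" using step by (simp add: reach_out_def)
      have xR: "x \<in> reach_in I h" using yR step by (auto simp: reach_in_def)
      have y'R: "y' \<in> reach_out I h" using reach_out_step[OF xR h(3)] step by blast
      have "y \<in> M I'" using step MM MM' by blast
      moreover have "y \<notin> M (I' - {x})" using Medge step yR RYY by blast
      moreover have "x \<in> I'" using xR RXT TI' by blast
      moreover have "y' \<notin> I'" using YI' y'R RYY by blast
      moreover have "y' \<in> N_rest I' I'" "y' \<notin> N_rest I' (I' - {x})" using Nedge[of x y'] xR RXT step by blast+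
      ultimately show ?case using alt_reach.step[of y M "N_rest I'" I' E "sources I' h" x y'] step
        unfolding reach_out_def by blast
    qed
    moreover have "x \<in> reach_in I' h" if x: "x \<in> reach_in I h" for x
    proof -
      obtain y where y: "y \<in> reach_out I h" "y \<notin> M (I - {x})" "x \<in> I" using x by (auto simp: reach_in_def)
      then have "y \<notin> M (I' - {x})" using Medge RYY by blast
      moreover have "x \<in> I'" using x RXT TI' by blast
      ultimately show ?thesis using mono[OF y(1)] by (auto simp: reach_in_def)
    qed
    ultimately show ?thesis by blast
  qed
  then show ?thesis using g' fI NIU by blast
qed

lemma key_lemma:
  assumes E: "countable E" and nowave: "\<And>W X. wave E M N {} W X \<Longrightarrow> W = {}"
    and fin: "\<And>x A. x \<in> N A \<Longrightarrow> x \<in> U \<Longrightarrow> \<exists>F. finite F \<and> F \<subseteq> A \<and> x \<in> N F"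
    and e: "e \<in> U" "e \<in> N E"
  shows "\<exists>I. good I \<and> e \<in> N I"
proof (rule ccontr)
  assume contr: "\<not> ?thesis"
  have g0: "good {}" unfolding good_def unhindered_def loose_def indep_wrt_def
    using nowave by blast
  \<comment> \<open>Besides \<open>e\<close>, which may lie outside \<open>E\<close>, all of
    \<open>E \<inter> U\<close> is scheduled: the limit argument needs that every element of
    \<open>E \<inter> U\<close> missed by the limit wave is eventually spanned, and \<open>e\<close>
    will be spanned through such elements.\<close>
  define T where "T = insert e (E \<inter> U)"
  have cT: "countable T" using E by (simp add: T_def countable_Int1)
  have TU: "T \<subseteq> U" using e by (auto simp: T_def)
  define ix where "ix = to_nat_on T"
  have ix: "inj_on ix T" unfolding ix_def by (rule inj_on_to_nat_on[OF cT])
  define aug where "aug I f \<longleftrightarrow> f \<in> T \<and> \<not> reach_out I f \<subseteq> M I" for I f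
  define Q where "Q I I' \<longleftrightarrow> N I \<inter> U \<subseteq> N I' \<and>
      (\<forall>f. aug I f \<longrightarrow> (\<exists>h. aug I h \<and> ix h \<le> ix f \<and> h \<in> N I')) \<and>
      (\<forall>h\<in>U. h \<notin> N I' \<longrightarrow> reach_out I h \<subseteq> M I \<longrightarrow> reach_out I h \<subseteq> reach_out I' h \<and> reach_in I h \<subseteq> reach_in I' h)" for I I'
  have "\<exists>\<sigma>. \<forall>n. good (\<sigma> n) \<and> Q (\<sigma> n) (\<sigma> (Suc n))"
  proof (rule dependent_nat_choice)
    show "\<exists>I. good I" using g0 by blast
    fix I and n :: nat assume g: "good I"
    show "\<exists>I'. good I' \<and> Q I I'"
    proof (cases "\<exists>f. aug I f")
      case False
      then have "Q I I" by (auto simp: Q_def)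
      then show ?thesis using g by blast
    next
      case True
      then obtain f where f: "aug I f" "\<And>h. aug I h \<Longrightarrow> ix f \<le> ix h"
        using exists_least_iff[of "\<lambda>i. \<exists>f. aug I f \<and> ix f = i"] by (metis linorder_not_le)
      then have "f \<in> U" "\<not> reach_out I f \<subseteq> M I" using TU by (auto simp: aug_def)
      from augment_step[OF E g this] show ?thesis using f unfolding Q_def by blast
    qed
  qed
  then obtain \<sigma> where \<sigma>: "\<And>n. good (\<sigma> n)" "\<And>n. Q (\<sigma> n) (\<sigma> (Suc n))" by blast
  have Nmono: "N (\<sigma> n) \<inter> U \<subseteq> N (\<sigma> m)" if "n \<le> m" for n m
    using that
  proof (induction m rule: dec_induct)
    case (step m)
    then show ?case using \<sigma>(2)[of m] unfolding Q_def by blast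
  qed simp
  define F where "F = {f \<in> T. \<forall>n. f \<notin> N (\<sigma> n)}"
  have FU: "F \<subseteq> U" using TU by (auto simp: F_def)
  have eF: "e \<in> F" using contr \<sigma>(1) by (auto simp: F_def T_def)
  have "\<exists>n0. \<forall>n\<ge>n0. reach_out (\<sigma> n) f \<subseteq> M (\<sigma> n)" if f: "f \<in> F" for f
  proof -
    define A where "A = {n. aug (\<sigma> n) f}"
    have "\<forall>n\<in>A. \<exists>h. aug (\<sigma> n) h \<and> ix h \<le> ix f \<and> h \<in> N (\<sigma> (Suc n))"
      using \<sigma>(2) unfolding Q_def A_def by blast
    then obtain h where h: "\<And>n. n \<in> A \<Longrightarrow> aug (\<sigma> n) (h n) \<and> ix (h n) \<le> ix f \<and> h n \<in> N (\<sigma> (Suc n))"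
      by metis
    have hn: "h n \<notin> N (\<sigma> n)" if n: "n \<in> A" for n
    proof
      assume "h n \<in> N (\<sigma> n)"
      then have "N (insert (h n) (\<sigma> n)) \<subseteq> N (\<sigma> n)"
        using N.ext[of "\<sigma> n"] by (intro N.least) blast
      then have "sources (\<sigma> n) (h n) = {}" by (auto simp: sources_def)
      then have "reach_out (\<sigma> n) (h n) = {}"
        unfolding reach_out_def by (auto elim: alt_reach.induct)
      then show False using h[OF n] by (simp add: aug_def)
    qed
    \<comment> \<open>The element \<open>h n\<close> is unspanned at stage \<open>n\<close> and
      spanned forever after, so no element is chosen twice. Only finitely many indices are at most
      \<open>ix f\<close>, which bounds the number of stages at which \<open>f\<close> has an
      augmenting path.\<close>
    have "inj_on (\<lambda>n. ix (h n)) A"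
    proof (rule linorder_inj_onI)
      fix n m assume nm: "n < m" "n \<in> A" "m \<in> A"
      have "h n \<in> N (\<sigma> m)"
        using Nmono[of "Suc n" m] nm h[of n] TU by (auto simp: aug_def)
      then have "h n \<noteq> h m" using hn nm by metis
      then show "ix (h n) \<noteq> ix (h m)" using ix h nm by (metis aug_def inj_onD)
    qed auto
    moreover have "(\<lambda>n. ix (h n)) ` A \<subseteq> {..ix f}" using h by auto
    ultimately have "finite A" by (meson finite_atMost finite_imageD finite_subset)
    then obtain n0 where "\<forall>n\<in>A. n < n0" using finite_nat_set_iff_bounded by blast
    then have "\<forall>n\<ge>n0. n \<notin> A" by fastforce
    then show ?thesis using f by (auto simp: A_def aug_def F_def)
  qed
  then obtain nf where nf: "\<And>f n. f \<in> F \<Longrightarrow> nf f \<le> n \<Longrightarrow> reach_out (\<sigma> n) f \<subseteq> M (\<sigma> n)" by metis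
  have Rmono: "reach_out (\<sigma> n) f \<subseteq> reach_out (\<sigma> m) f \<and> reach_in (\<sigma> n) f \<subseteq> reach_in (\<sigma> m) f"
    if f: "f \<in> F" "nf f \<le> n" and "n \<le> m" for f n m
    using that(3)
  proof (induction m rule: dec_induct)
    case (step m)
    have "f \<in> U" "f \<notin> N (\<sigma> (Suc m))" "reach_out (\<sigma> m) f \<subseteq> M (\<sigma> m)"
      using f FU nf[OF f(1), of m] step by (auto simp: F_def)
    then have "reach_out (\<sigma> m) f \<subseteq> reach_out (\<sigma> (Suc m)) f \<and> reach_in (\<sigma> m) f \<subseteq> reach_in (\<sigma> (Suc m)) f"
      using \<sigma>(2)[of m] unfolding Q_def by blast
    then show ?case using step by blast
  qed simp
  define Ylim where "Ylim = (\<Union>f\<in>F. \<Union>n\<in>{nf f..}. reach_out (\<sigma> n) f)"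
  define Xlim where "Xlim = (\<Union>f\<in>F. \<Union>n\<in>{nf f..}. reach_in (\<sigma> n) f)"
  have \<sigma>E: "\<sigma> n \<subseteq> E" and \<sigma>M: "indep_wrt M (\<sigma> n)" and \<sigma>N: "indep_wrt (N_rest (\<sigma> n)) (\<sigma> n)" for n
    using \<sigma>(1) by (auto simp: good_def)
  have RXin: "\<exists>n0. \<forall>n\<ge>n0. x \<in> \<sigma> n" if "x \<in> Xlim" for x
  proof -
    obtain f n where f: "f \<in> F" "nf f \<le> n" "x \<in> reach_in (\<sigma> n) f" using \<open>x \<in> Xlim\<close> by (auto simp: Xlim_def)
    then have "x \<in> \<sigma> m" if "n \<le> m" for m using Rmono[OF f(1,2) that] by (auto simp: reach_in_def)
    then show ?thesis by blast
  qed
  have disj: "x \<notin> Xlim" if x: "f \<in> F" "nf f \<le> n" "x \<in> reach_out (\<sigma> n) f" for x f n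
  proof
    assume "x \<in> Xlim"
    then obtain n0 where "\<forall>m\<ge>n0. x \<in> \<sigma> m" using RXin by blast
    then have "x \<in> \<sigma> (max n0 n)" by simp
    moreover have "x \<in> reach_out (\<sigma> (max n0 n)) f" using Rmono[OF x(1,2), of "max n0 n"] x(3) by auto
    ultimately show False using reach_out_notin by blast
  qed
  have FR: "F \<inter> E \<subseteq> Ylim"
  proof
    fix f assume f: "f \<in> F \<inter> E"
    then have "f \<in> sources (\<sigma> (nf f)) f" using FU by (auto simp: sources_def F_def intro: N.in_ext)
    then have "f \<in> reach_out (\<sigma> (nf f)) f" unfolding reach_out_def by (rule alt_reach.src)
    then show "f \<in> Ylim" using f by (auto simp: Ylim_def)
  qed
  have later: "\<exists>n0. \<forall>n\<ge>n0. a \<in> N (\<sigma> n)" if a: "a \<in> E" "a \<in> U" "a \<notin> Ylim" for a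
  proof -
    have "a \<in> T" "a \<notin> F" using a FR by (auto simp: T_def)
    then obtain n0 where "a \<in> N (\<sigma> n0)" by (auto simp: F_def)
    then show ?thesis using Nmono a by blast
  qed
  have "wave E M N {} (Ylim \<union> Xlim) Xlim"
    unfolding wave_def
  proof (intro conjI)
    have "Ylim \<subseteq> E" using reach_out_notin by (auto simp: Ylim_def)
    moreover have "Xlim \<subseteq> E" using \<sigma>E by (auto simp: Xlim_def reach_in_def)
    ultimately show "Ylim \<union> Xlim \<subseteq> E" by blast
    have "Ylim \<subseteq> M Xlim"
    proof
      fix y assume "y \<in> Ylim"
      then obtain f n where f: "f \<in> F" "nf f \<le> n" "y \<in> reach_out (\<sigma> n) f" by (auto simp: Ylim_def)
      then have "y \<in> M (reach_in (\<sigma> n) f)" using reach_out_span[OF \<sigma>M] nf by blast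
      then show "y \<in> M Xlim" by (rule M.in_mono) (use f in \<open>auto simp: Xlim_def\<close>)
    qed
    then show "Ylim \<union> Xlim \<subseteq> M ({} \<union> Xlim)" using M.ext[of Xlim] by simp
    show "indep_wrt (\<lambda>A. N (A \<union> (E - (Ylim \<union> Xlim)))) Xlim"
      unfolding indep_wrt_def
    proof (intro ballI notI)
      fix x assume x: "x \<in> Xlim" "x \<in> N (Xlim - {x} \<union> (E - (Ylim \<union> Xlim)))"
      obtain f n where f: "f \<in> F" "nf f \<le> n" "x \<in> reach_in (\<sigma> n) f" using x by (auto simp: Xlim_def)
      have xm: "x \<in> reach_in (\<sigma> m) f" "x \<in> \<sigma> m" if "n \<le> m" for m
        using Rmono[OF f(1,2) that] f(3) by (auto simp: reach_in_def)
      have edge: "a \<in> reach_out (\<sigma> m) f" "a \<in> Ylim" "a \<notin> Xlim"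
        if "n \<le> m" "a \<in> E" "a \<notin> \<sigma> m" "a \<in> N_rest (\<sigma> m) (\<sigma> m)" "a \<notin> N_rest (\<sigma> m) (\<sigma> m - {x})" for a m
      proof -
        have m: "nf f \<le> m" using f that by simp
        show a: "a \<in> reach_out (\<sigma> m) f" using reach_out_step[OF xm(1)[OF that(1)] nf[OF f(1) m]] that by blast
        show "a \<in> Ylim" using a f m by (auto simp: Ylim_def)
        show "a \<notin> Xlim" using disj[OF f(1) m a] .
      qed
      show False
      proof (cases "x \<in> U")
        case True
        \<comment> \<open>Inside \<open>U\<close> a finite set already spans \<open>x\<close>. At a
          late stage each of its members is present or spanned, and none of the spanned ones needs
          \<open>x\<close>, since otherwise it would be reachable.\<close>
        then have "x \<in> N ((Xlim - {x} \<union> (E - (Ylim \<union> Xlim))) \<inter> U)" using split_in x by blast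
        then obtain A where A: "finite A" "A \<subseteq> (Xlim - {x} \<union> (E - (Ylim \<union> Xlim))) \<inter> U" "x \<in> N A"
          using fin[OF _ True] by metis
        have "\<exists>n0. \<forall>m\<ge>n0. a \<in> N (\<sigma> m) \<and> (a \<in> Xlim \<longrightarrow> a \<in> \<sigma> m)" if a: "a \<in> A" for a
        proof (cases "a \<in> Xlim")
          case True
          then show ?thesis using RXin[OF True] N.in_ext by blast
        next
          case False
          then show ?thesis using later[of a] a A(2) by blast
        qed
        then obtain na where na: "\<And>a m. a \<in> A \<Longrightarrow> na a \<le> m \<Longrightarrow> a \<in> N (\<sigma> m) \<and> (a \<in> Xlim \<longrightarrow> a \<in> \<sigma> m)"
          by metis
        define m where "m = Max (insert n (na ` A))"
        have m: "n \<le> m" "\<And>a. a \<in> A \<Longrightarrow> na a \<le> m" using A(1) by (auto simp: m_def)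
        have "A \<subseteq> N (\<sigma> m - {x})"
        proof
          fix a assume a: "a \<in> A"
          then have ax: "a \<noteq> x" "a \<in> U" using A(2) x(1) by auto
          show "a \<in> N (\<sigma> m - {x})"
          proof (cases "a \<in> \<sigma> m")
            case True
            then show ?thesis using ax by (intro N.in_ext) auto
          next
            case False
            then have "a \<in> E" "a \<notin> Ylim" using na[OF a m(2)[OF a]] a A(2) by auto
            then show ?thesis using edge(2)[OF m(1), of a] False na[OF a m(2)[OF a]] N_rest_in_U[OF ax(2)] by blast
          qed
        qed
        then have "x \<in> N (\<sigma> m - {x})" using N.in_trans[OF A(3)] by blast
        then have "x \<in> N_rest (\<sigma> m) (\<sigma> m - {x})" using N_rest_in_U[OF True] by blast
        then show False using \<sigma>N xm(2)[OF m(1)] by (auto simp: indep_wrt_def)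
      next
        case False
        then have xx: "x \<in> N ((Xlim - {x} \<union> (E - (Ylim \<union> Xlim))) - U)" using split_out x by blast
        interpret K: closure_matroid "N_rest (\<sigma> n)" by (rule N_rest_matroid)
        \<comment> \<open>Outside \<open>U\<close> the spanning set may be infinite, but stage
          \<open>n\<close> alone suffices: what \<open>\<sigma> n\<close> does not yet span in
          \<open>M\<close> belongs to \<open>outer_rest (\<sigma> n)\<close>, and what it spans
          needs no \<open>x\<close>.\<close>
        have "(Xlim - {x} \<union> (E - (Ylim \<union> Xlim))) - U \<subseteq> N_rest (\<sigma> n) (\<sigma> n - {x})"
        proof
          fix a assume a: "a \<in> (Xlim - {x} \<union> (E - (Ylim \<union> Xlim))) - U"
          have aE: "a \<in> E" using a \<sigma>E by (auto simp: Xlim_def reach_in_def)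
          have ax: "a \<noteq> x" using a x(1) by auto
          show "a \<in> N_rest (\<sigma> n) (\<sigma> n - {x})"
          proof (cases "a \<in> \<sigma> n")
            case True
            then show ?thesis using ax by (intro K.in_ext) auto
          next
            case an: False
            show ?thesis
            proof (cases "a \<in> M (\<sigma> n)")
              case True
              then have "a \<in> N_rest (\<sigma> n) (\<sigma> n)" using spanned_in_good[OF \<sigma>(1)] aE a by blast
              then show ?thesis using edge[OF order_refl aE an] a by blast
            next
              case False
              then have "a \<in> outer_rest (\<sigma> n)" using aE a by (auto simp: outer_rest_def)
              then show ?thesis unfolding N_rest_def by (intro N.in_ext) auto
            qed
          qed
        qed
        then have "x \<in> N_rest (\<sigma> n) (\<sigma> n - {x})"
          using N.in_trans[OF xx] unfolding N_rest_def by blast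
        then show False using \<sigma>N xm(2)[OF order_refl] by (auto simp: indep_wrt_def)
      qed
    qed
  qed auto
  then have empty: "Ylim = {}" using nowave by blast
  \<comment> \<open>With \<open>Ylim\<close> empty, every element of \<open>E \<inter> U\<close> is
    eventually spanned, in particular the finitely many that span \<open>e\<close>.\<close>
  have "e \<in> N (E \<inter> U)" using split_in e by blast
  then obtain A where A: "finite A" "A \<subseteq> E \<inter> U" "e \<in> N A" using fin[OF _ e(1)] by metis
  have "\<exists>n0. \<forall>m\<ge>n0. a \<in> N (\<sigma> m)" if "a \<in> A" for a using later[of a] that A(2) empty by blast
  then obtain na where na: "\<And>a m. a \<in> A \<Longrightarrow> na a \<le> m \<Longrightarrow> a \<in> N (\<sigma> m)" by metis
  define m where "m = Max (insert 0 (na ` A))"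
  have "A \<subseteq> N (\<sigma> m)" using na A(1) by (auto simp: m_def)
  then have "e \<in> N (\<sigma> m)" using N.in_trans[OF A(3)] by blast
  then show False using eF by (auto simp: F_def)
qed

end

section \<open>Duality and the countable construction\<close>

text \<open>An element of \<open>E - A\<close> is spanned by \<open>A\<close> in the dual exactly if
  it is a coloop of the restriction to \<open>E - A\<close>.\<close>

definition dual_cl :: "'a set \<Rightarrow> ('a set \<Rightarrow> 'a set) \<Rightarrow> 'a set \<Rightarrow> 'a set" where
  "dual_cl E cl A = A \<union> {x \<in> E. x \<notin> cl (E - A - {x})}"

lemma (in closure_matroid) dual: "closure_matroid (dual_cl E cl)"
proof
  fix A show "A \<subseteq> dual_cl E cl A" by (auto simp: dual_cl_def)
next
  fix A B :: "'a set" assume "A \<subseteq> B"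
  then have "cl (E - B - {x}) \<subseteq> cl (E - A - {x})" for x by (intro mono) auto
  then show "dual_cl E cl A \<subseteq> dual_cl E cl B" using \<open>A \<subseteq> B\<close> by (auto simp: dual_cl_def)
next
  fix A
  show "dual_cl E cl (dual_cl E cl A) \<subseteq> dual_cl E cl A"
  proof
    fix x assume x: "x \<in> dual_cl E cl (dual_cl E cl A)"
    show "x \<in> dual_cl E cl A"
    proof (rule ccontr)
      assume n: "x \<notin> dual_cl E cl A"
      define T where "T = E - A"
      \<comment> \<open>Idempotence amounts to this: deleting the set \<open>L\<close> of all
        coloops of \<open>T\<close>, however large, creates no new coloop \<open>x\<close>. A basis
        of \<open>T - L - {x}\<close> enlarged by \<open>x\<close> extends to a basis
        \<open>C\<close> of \<open>T\<close>. It contains \<open>L\<close>, so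
        \<open>C - {x}\<close> still spans \<open>T - {x}\<close> and thereby
        \<open>x\<close>.\<close>
      define L where "L = {y \<in> T. y \<notin> cl (T - {y})}"
      have TL: "E - dual_cl E cl A = T - L" by (auto simp: T_def L_def dual_cl_def)
      have xE: "x \<in> E" "x \<notin> cl (T - L - {x})" using x n TL by (auto simp: dual_cl_def)
      have xT: "x \<in> T" "x \<in> cl (T - {x})" "x \<notin> L" using n xE by (auto simp: dual_cl_def T_def L_def)
      obtain B where B: "B \<subseteq> T - L - {x}" "indep_wrt cl B" "T - L - {x} \<subseteq> cl B"
        using base[OF indep_empty, of "T - L - {x}"] by blast
      have "x \<notin> cl B" using xE(2) mono[OF B(1)] by blast
      then have "indep_wrt cl (insert x B)" by (rule indep_insert[OF B(2)])
      then obtain C where C: "insert x B \<subseteq> C" "C \<subseteq> T" "indep_wrt cl C" "T \<subseteq> cl C"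
        using base[of "insert x B" T] B(1) xT(1) by blast
      have LC: "L \<subseteq> C"
      proof
        fix y assume y: "y \<in> L"
        show "y \<in> C"
        proof (rule ccontr)
          assume "y \<notin> C"
          then have "cl C \<subseteq> cl (T - {y})" using C(2) by (intro mono) auto
          then show False using y C(4) by (auto simp: L_def)
        qed
      qed
      have "T - {x} \<subseteq> cl (C - {x})"
      proof
        fix y assume y: "y \<in> T - {x}"
        show "y \<in> cl (C - {x})"
        proof (cases "y \<in> L")
          case True
          then show ?thesis using LC y by (intro in_ext) auto
        next
          case False
          then have "y \<in> cl B" using B(3) y by blast
          then show ?thesis by (rule in_mono) (use B C in auto)
        qed
      qed
      then have "x \<in> cl (C - {x})" by (rule in_trans[OF xT(2)])
      then show False using C(1,3) by (auto simp: indep_wrt_def)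
    qed
  qed
next
  fix x y A assume y: "y \<in> dual_cl E cl (insert x A)" "y \<notin> dual_cl E cl A"
  show "x \<in> dual_cl E cl (insert y A)"
  proof (cases "y = x")
    case True
    then show ?thesis by (simp add: dual_cl_def)
  next
    case False
    then have yE: "y \<in> E" "y \<notin> cl (E - insert x A - {y})" "y \<in> cl (E - A - {y})"
      using y by (auto simp: dual_cl_def)
    have xE: "x \<in> E - A"
    proof (rule ccontr)
      assume "x \<notin> E - A"
      then have "E - insert x A = E - A" by auto
      then show False using yE by simp
    qed
    have e: "E - insert y A - {x} = E - insert x A - {y}" by auto
    have "x \<notin> cl (E - insert y A - {x})"
    proof
      assume "x \<in> cl (E - insert y A - {x})"
      then have "E - A - {y} \<subseteq> cl (E - insert x A - {y})"
        using ext[of "E - insert x A - {y}"] unfolding e by blast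
      then show False using yE in_trans[OF yE(3)] by blast
    qed
    then show ?thesis using xE by (simp add: dual_cl_def)
  qed
next
  fix A S assume A: "indep_wrt (dual_cl E cl) A" "A \<subseteq> S"
  have AE: "a \<in> cl (E - A)" if a: "a \<in> A" "a \<in> E" for a
  proof -
    have "a \<notin> dual_cl E cl (A - {a})" using A(1) a by (simp add: indep_wrt_def)
    then have "a \<in> cl (E - (A - {a}) - {a})" using a by (simp add: dual_cl_def)
    moreover have "E - (A - {a}) - {a} = E - A" using a by auto
    ultimately show ?thesis by simp
  qed
  \<comment> \<open>A basis of \<open>E - A\<close> that begins with a basis of \<open>E - S\<close>
    leaves in \<open>S\<close> a dual basis of \<open>S\<close> containing \<open>A\<close>.\<close>
  obtain B1 where B1: "B1 \<subseteq> E - S" "indep_wrt cl B1" "E - S \<subseteq> cl B1"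
    using base[OF indep_empty, of "E - S"] by blast
  obtain B2 where B2: "B1 \<subseteq> B2" "B2 \<subseteq> E - A" "indep_wrt cl B2" "E - A \<subseteq> cl B2"
    using base[OF B1(2), of "E - A"] B1(1) A(2) by blast
  have all: "E \<subseteq> cl B2"
  proof
    fix a assume "a \<in> E"
    then show "a \<in> cl B2" using B2(4) AE least[OF B2(4)] by blast
  qed
  show "\<exists>B. A \<subseteq> B \<and> B \<subseteq> S \<and> indep_wrt (dual_cl E cl) B \<and> S \<subseteq> dual_cl E cl B"
  proof (intro exI[of _ "S - B2"] conjI)
    show "A \<subseteq> S - B2" using A(2) B2(2) by blast
    show "S - B2 \<subseteq> S" by blast
    show "indep_wrt (dual_cl E cl) (S - B2)" unfolding indep_wrt_def
    proof (intro ballI notI)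
      fix b assume b: "b \<in> S - B2" "b \<in> dual_cl E cl (S - B2 - {b})"
      then have "b \<in> E" "b \<notin> cl (E - (S - B2 - {b}) - {b})" by (auto simp: dual_cl_def)
      moreover have "B2 \<subseteq> E - (S - B2 - {b}) - {b}" using B2(2) b(1) by blast
      ultimately show False using all mono[of B2 "E - (S - B2 - {b}) - {b}"] by blast
    qed
    show "S \<subseteq> dual_cl E cl (S - B2)"
    proof
      fix s assume s: "s \<in> S"
      show "s \<in> dual_cl E cl (S - B2)"
      proof (cases "s \<in> B2")
        case False
        then show ?thesis using s by (simp add: dual_cl_def)
      next
        case True
        have "s \<notin> cl (E - (S - B2) - {s})"
        proof
          assume sc: "s \<in> cl (E - (S - B2) - {s})"
          have "B1 \<subseteq> B2 - {s}" using B1(1) B2(1) s by blast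
          then have "E - S \<subseteq> cl (B2 - {s})" using B1(3) mono[of B1 "B2 - {s}"] by blast
          then have "E - (S - B2) - {s} \<subseteq> cl (B2 - {s})" using ext[of "B2 - {s}"] by blast
          then have "s \<in> cl (B2 - {s})" by (rule in_trans[OF sc])
          then show False using B2(3) True by (simp add: indep_wrt_def)
        qed
        then show ?thesis using True B2(2) by (auto simp: dual_cl_def)
      qed
    qed
  qed
qed

text \<open>The pair \<open>(M / I - J, N / I - J)\<close> has no nonempty wave. In terms of the dual \<open>K\<close> of \<open>N\<close>, a wave
  is a set that splits into an \<open>M\<close>-spanning and a \<open>K\<close>-spanning part, whence the symmetry below.\<close>

definition state ::
    "'a set \<Rightarrow> ('a set \<Rightarrow> 'a set) \<Rightarrow> ('a set \<Rightarrow> 'a set) \<Rightarrow> 'a set \<Rightarrow> 'a set \<Rightarrow> bool" where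
  "state E M N I J \<longleftrightarrow> I \<subseteq> E \<and> J \<subseteq> E \<and> I \<inter> J = {} \<and> indep_wrt M I \<and> J \<subseteq> N (E - J) \<and>
     (\<forall>W X. W \<subseteq> E - I - J \<longrightarrow> X \<subseteq> W \<longrightarrow> W \<subseteq> M (I \<union> X) \<longrightarrow>
        (\<forall>x\<in>X. x \<notin> N (X - {x} \<union> (E - J - W))) \<longrightarrow> W = {})"

section \<open>Extension steps for states and their limit\<close>

context closure_pair
begin

text \<open>The dual wave lives on the same \<open>W\<close> with the complementary witness
  \<open>W - X\<close>: that \<open>X\<close> spans \<open>W\<close> means that \<open>W - X\<close>
  is independent in the dual over the complement, and conversely.\<close>

lemma state_dual: "state E M N I J \<longleftrightarrow> state E (dual_cl E N) (dual_cl E M) J I"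
proof (cases "I \<subseteq> E \<and> J \<subseteq> E \<and> I \<inter> J = {}")
  case True
  have iI: "indep_wrt M I \<longleftrightarrow> I \<subseteq> dual_cl E M (E - I)"
  proof -
    have "x \<in> dual_cl E M (E - I) \<longleftrightarrow> x \<notin> M (I - {x})" if "x \<in> I" for x
    proof -
      have "E - (E - I) - {x} = I - {x}" using True by auto
      then show ?thesis using that True by (auto simp: dual_cl_def)
    qed
    then show ?thesis by (auto simp: indep_wrt_def)
  qed
  have iJ: "indep_wrt (dual_cl E N) J \<longleftrightarrow> J \<subseteq> N (E - J)"
  proof -
    have "x \<in> dual_cl E N (J - {x}) \<longleftrightarrow> x \<notin> N (E - J)" if "x \<in> J" for x
    proof -
      have "E - (J - {x}) - {x} = E - J" using that by auto
      then show ?thesis using that True by (auto simp: dual_cl_def)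
    qed
    then show ?thesis by (auto simp: indep_wrt_def)
  qed
  have cA: "W \<subseteq> M (I \<union> X) \<longleftrightarrow> (\<forall>y\<in>W - X. y \<notin> dual_cl E M ((W - X) - {y} \<union> (E - I - W)))"
    if W: "W \<subseteq> E - I - J" "X \<subseteq> W" for W X
  proof -
    have "y \<notin> dual_cl E M ((W - X) - {y} \<union> (E - I - W)) \<longleftrightarrow> y \<in> M (I \<union> X)" if "y \<in> W - X" for y
    proof -
      have "E - ((W - X) - {y} \<union> (E - I - W)) - {y} = I \<union> X" using W True that by auto
      then show ?thesis using that W by (auto simp: dual_cl_def)
    qed
    moreover have "X \<subseteq> M (I \<union> X)" using M.ext[of "I \<union> X"] by blast
    ultimately show ?thesis by blast
  qed
  have cB: "(\<forall>x\<in>X. x \<notin> N (X - {x} \<union> (E - J - W))) \<longleftrightarrow> W \<subseteq> dual_cl E N (J \<union> (W - X))"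
    if W: "W \<subseteq> E - I - J" "X \<subseteq> W" for W X
  proof -
    have "x \<notin> N (X - {x} \<union> (E - J - W)) \<longleftrightarrow> x \<in> dual_cl E N (J \<union> (W - X))" if "x \<in> X" for x
    proof -
      have "E - (J \<union> (W - X)) - {x} = X - {x} \<union> (E - J - W)" using W that by auto
      then show ?thesis using that W by (auto simp: dual_cl_def)
    qed
    moreover have "W - X \<subseteq> dual_cl E N (J \<union> (W - X))" by (auto simp: dual_cl_def)
    ultimately show ?thesis using W(2) by blast
  qed
  have "(\<forall>W X. W \<subseteq> E - I - J \<longrightarrow> X \<subseteq> W \<longrightarrow> W \<subseteq> M (I \<union> X) \<longrightarrow>
        (\<forall>x\<in>X. x \<notin> N (X - {x} \<union> (E - J - W))) \<longrightarrow> W = {}) \<longleftrightarrow>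
      (\<forall>W Y. W \<subseteq> E - J - I \<longrightarrow> Y \<subseteq> W \<longrightarrow> W \<subseteq> dual_cl E N (J \<union> Y) \<longrightarrow>
        (\<forall>y\<in>Y. y \<notin> dual_cl E M (Y - {y} \<union> (E - I - W))) \<longrightarrow> W = {})" (is "?l \<longleftrightarrow> ?r")
  proof
    assume l: ?l
    show ?r
    proof (intro allI impI)
      fix W Y assume a: "W \<subseteq> E - J - I" "Y \<subseteq> W" "W \<subseteq> dual_cl E N (J \<union> Y)"
        "\<forall>y\<in>Y. y \<notin> dual_cl E M (Y - {y} \<union> (E - I - W))"
      have e: "W - (W - Y) = Y" "W \<subseteq> E - I - J" "W - Y \<subseteq> W" using a by auto
      have "W \<subseteq> M (I \<union> (W - Y))" using cA[OF e(2,3)] a(4) e(1) by simp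
      moreover have "\<forall>x\<in>W - Y. x \<notin> N (W - Y - {x} \<union> (E - J - W))" using cB[OF e(2,3)] a(3) e(1) by simp
      ultimately show "W = {}" using l e(2,3) by blast
    qed
  next
    assume r: ?r
    show ?l
    proof (intro allI impI)
      fix W X assume a: "W \<subseteq> E - I - J" "X \<subseteq> W" "W \<subseteq> M (I \<union> X)"
        "\<forall>x\<in>X. x \<notin> N (X - {x} \<union> (E - J - W))"
      have e: "W \<subseteq> E - J - I" "W - X \<subseteq> W" using a by auto
      show "W = {}" using r cA[OF a(1,2)] cB[OF a(1,2)] a e by blast
    qed
  qed
  then show ?thesis unfolding state_def using True iI iJ by blast
next
  case False
  then show ?thesis unfolding state_def by blast
qed

lemma state_wave:
  assumes s: "state E M N I J"
    and w: "wave (E - I - J) (\<lambda>A. M (A \<union> I)) (\<lambda>A. N (A \<union> I)) {} W X"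
  shows "W = {}"
proof -
  have W: "W \<subseteq> E - I - J" "X \<subseteq> W" "W \<subseteq> M (I \<union> X)" using w by (auto simp: wave_def Un_commute)
  have "X - {x} \<union> (E - I - J - W) \<union> I = X - {x} \<union> (E - J - W)" for x
    using W s by (auto simp: state_def)
  then have "\<forall>x\<in>X. x \<notin> N (X - {x} \<union> (E - J - W))" using w by (simp add: wave_def indep_wrt_def)
  then show ?thesis using s W unfolding state_def by blast
qed

text \<open>Looseness leaves only waves of loops, so deleting the loops of \<open>M\<close> that
  \<open>I'\<close> creates removes all waves. These loops form a wave with empty witness;
  unhinderedness says that the elements kept span them in \<open>N\<close>, as a state requires of
  \<open>J\<close>.\<close>

lemma state_extend:
  assumes s: "state E M N I J" and IE: "I' \<subseteq> E - I - J"
    and iM: "indep_wrt (\<lambda>A. M (A \<union> I)) I'"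
    and unh: "unhindered (E - I - J) (\<lambda>A. M (A \<union> I)) (\<lambda>A. N (A \<union> I)) I'"
    and lo: "loose (E - I - J) (\<lambda>A. M (A \<union> I)) (\<lambda>A. N (A \<union> I)) I'"
  shows "state E M N (I \<union> I') (J \<union> ((E - I - J) \<inter> M (I' \<union> I) - I'))"
proof -
  let ?E = "E - I - J" and ?M = "\<lambda>A. M (A \<union> I)" and ?N = "\<lambda>A. N (A \<union> I)"
  define J' where "J' = ?E \<inter> M (I' \<union> I) - I'"
  have s': "I \<subseteq> E" "J \<subseteq> E" "I \<inter> J = {}" "indep_wrt M I" "J \<subseteq> N (E - J)" using s by (auto simp: state_def)
  have J'E: "J' \<subseteq> ?E" "J' \<inter> I' = {}" by (auto simp: J'_def)
  have "indep_wrt M (I' \<union> I)" by (rule M.indep_Un[OF s'(4) iM]) simp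
  then have 1: "indep_wrt M (I \<union> I')" by (simp add: Un_commute)
  have "wave ?E ?M ?N I' J' {}" by (auto simp: wave_def J'_def indep_wrt_def)
  then have "J' \<subseteq> N ({} \<union> (?E - J') \<union> I)" using unh unfolding unhindered_def by blast
  moreover have "{} \<union> (?E - J') \<union> I = E - (J \<union> J')" using s' J'E by auto
  ultimately have J': "J' \<subseteq> N (E - (J \<union> J'))" by simp
  have "E - J \<subseteq> N (E - (J \<union> J'))" using J' N.ext[of "E - (J \<union> J')"] by blast
  then have 2: "J \<union> J' \<subseteq> N (E - (J \<union> J'))" using J' s'(5) N.least[of "E - J"] by blast
  have 3: "W = {}" if W: "W \<subseteq> E - (I \<union> I') - (J \<union> J')" "X \<subseteq> W" "W \<subseteq> M (I \<union> I' \<union> X)"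
      "\<forall>x\<in>X. x \<notin> N (X - {x} \<union> (E - (J \<union> J') - W))" for W X
  proof -
    have "wave ?E ?M ?N I' (W \<union> J') X"
      unfolding wave_def
    proof (intro conjI)
      show "W \<union> J' \<subseteq> ?E" "(W \<union> J') \<inter> I' = {}" "X \<subseteq> W \<union> J'" using W J'E by auto
      have "J' \<subseteq> M (I' \<union> X \<union> I)" using M.mono[of "I' \<union> I" "I' \<union> X \<union> I"] by (auto simp: J'_def)
      moreover have "I \<union> I' \<union> X = I' \<union> X \<union> I" by auto
      ultimately show "W \<union> J' \<subseteq> M (I' \<union> X \<union> I)" using W(3) by simp
      have "X - {x} \<union> (?E - (W \<union> J')) \<union> I = X - {x} \<union> (E - (J \<union> J') - W)" for x
        using W s' J'E by auto
      then show "indep_wrt (\<lambda>A. N (A \<union> (?E - (W \<union> J')) \<union> I)) X" using W(4) by (simp add: indep_wrt_def)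
    qed
    then have "W \<union> J' \<subseteq> M (I' \<union> I)" using lo unfolding loose_def by blast
    then show ?thesis using W(1) by (auto simp: J'_def)
  qed
  show ?thesis unfolding J'_def[symmetric] state_def
    using s' IE J'E 1 2 3 by (intro conjI allI impI) auto
qed

text \<open>\<open>e\<close> is no loop of \<open>M / I\<close>, as \<open>{e}\<close> would then be
  a wave, so it can be put into \<open>I\<close>. With \<open>U = UNIV\<close> the set
  \<open>outer_rest\<close> is empty and \<open>augment_unhindered\<close> applies to every
  \<open>N\<close>.\<close>

lemma state_place:
  assumes E: "countable E" and s: "state E M N I J" and e: "e \<in> E - I - J"
  shows "\<exists>I' J'. I \<subseteq> I' \<and> J \<subseteq> J' \<and> state E M N I' J' \<and> e \<in> I'"
proof -
  let ?E = "E - I - J" and ?M = "\<lambda>A. M (A \<union> I)" and ?N = "\<lambda>A. N (A \<union> I)"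
  interpret M': closure_matroid ?M by (rule M.contract)
  interpret N': closure_matroid ?N by (rule N.contract)
  interpret S: split_pair ?M ?N ?E UNIV by unfold_locales auto
  have g: "S.good {}"
    unfolding S.good_def unhindered_def loose_def indep_wrt_def using state_wave[OF s] by blast
  have eM: "e \<notin> M ({} \<union> I)"
  proof
    assume "e \<in> M ({} \<union> I)"
    then have "wave ?E ?M ?N {} {e} {}" using e by (auto simp: wave_def indep_wrt_def)
    then show False using state_wave[OF s] by blast
  qed
  have "unhindered ?E ?M ?N {e}"
    by (rule S.augment_unhindered[OF g e eM]) (use e in auto)
  moreover have "indep_wrt ?M {e}" using eM by (simp add: indep_wrt_def)
  ultimately obtain I' where I': "{e} \<subseteq> I'" "I' \<subseteq> ?E" "indep_wrt ?M I'" "unhindered ?E ?M ?N I'" "loose ?E ?M ?N I'"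
    using S.absorb[of ?E "{e}"] E e by (metis (no_types, lifting) countable_Diff empty_subsetI insert_subset)
  from state_extend[OF s I'(2-5)] show ?thesis using I'(1)
    by (intro exI[of _ "I \<union> I'"] exI[of _ "J \<union> (?E \<inter> M (I' \<union> I) - I')"]) auto
qed

text \<open>The deleted element \<open>e\<close> is not in the current ground set, but what has not
  been deleted still spans it in \<open>N\<close>; this is the hypothesis under which
  \<open>key_lemma\<close> finds an extension of \<open>I\<close> spanning it.\<close>

lemma state_span:
  assumes E: "countable E" and s: "state E M N I J" and e: "e \<in> J" "e \<in> U"
    and split_in: "\<And>x A. x \<in> N A \<Longrightarrow> x \<in> U \<Longrightarrow> x \<in> N (A \<inter> U)"
    and split_out: "\<And>x A. x \<in> N A \<Longrightarrow> x \<notin> U \<Longrightarrow> x \<in> N (A - U)"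
    and fin: "\<And>x A. x \<in> N A \<Longrightarrow> x \<in> U \<Longrightarrow> \<exists>F. finite F \<and> F \<subseteq> A \<and> x \<in> N F"
  shows "\<exists>I' J'. I \<subseteq> I' \<and> J \<subseteq> J' \<and> state E M N I' J' \<and> e \<in> N I'"
proof -
  let ?E = "E - I - J" and ?M = "\<lambda>A. M (A \<union> I)" and ?N = "\<lambda>A. N (A \<union> I)"
  interpret M': closure_matroid ?M by (rule M.contract)
  interpret N': closure_matroid ?N by (rule N.contract)
  interpret S: split_pair ?M ?N ?E U
  proof
    fix x A assume "x \<in> N (A \<union> I)" "x \<in> U"
    then have "x \<in> N ((A \<union> I) \<inter> U)" by (rule split_in)
    then show "x \<in> N (A \<inter> U \<union> I)" by (rule N.in_mono) auto
  next
    fix x A assume "x \<in> N (A \<union> I)" "x \<notin> U"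
    then have "x \<in> N (A \<union> I - U)" by (rule split_out)
    then show "x \<in> N (A - U \<union> I)" by (rule N.in_mono) auto
  qed
  have "\<exists>I'. S.good I' \<and> e \<in> N (I' \<union> I)"
  proof (rule S.key_lemma)
    show "countable ?E" using E by simp
    show "W = {}" if "wave ?E ?M ?N {} W X" for W X using state_wave[OF s that] .
    show "\<exists>F. finite F \<and> F \<subseteq> A \<and> x \<in> N (F \<union> I)" if x: "x \<in> N (A \<union> I)" "x \<in> U" for x A
    proof -
      obtain F where F: "finite F" "F \<subseteq> A \<union> I" "x \<in> N F" using fin[OF x] by blast
      have "x \<in> N (F \<inter> A \<union> I)" by (rule N.in_mono[OF F(3)]) (use F(2) in auto)
      then show ?thesis using F by (intro exI[of _ "F \<inter> A"]) auto
    qed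
    show "e \<in> U" by (rule e)
    have "?E \<union> I = E - J" using s by (auto simp: state_def)
    then show "e \<in> N (?E \<union> I)" using s e by (auto simp: state_def)
  qed
  then obtain I' where I': "S.good I'" "e \<in> N (I' \<union> I)" by blast
  then have g: "I' \<subseteq> ?E" "indep_wrt ?M I'" "unhindered ?E ?M ?N I'" "loose ?E ?M ?N I'"
    by (auto simp: S.good_def)
  from state_extend[OF s g] show ?thesis using I'(2)
    by (intro exI[of _ "I \<union> I'"] exI[of _ "J \<union> (?E \<inter> M (I' \<union> I) - I')"]) (auto simp: Un_commute)
qed

text \<open>\<open>VN\<close> is the finitary part of \<open>N\<close>, \<open>VM\<close> the
  cofinitary part of \<open>M\<close>. A requirement on \<open>VM\<close> is one of the first kind
  for the dual pair, with \<open>I\<close> and \<open>J\<close> interchanged.\<close>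

lemma cover_of_no_waves:
  assumes E: "countable E" and s0: "state E M N {} {}"
    and N_in: "\<And>x A. x \<in> N A \<Longrightarrow> x \<in> VN \<Longrightarrow> x \<in> N (A \<inter> VN)"
    and N_out: "\<And>x A. x \<in> N A \<Longrightarrow> x \<notin> VN \<Longrightarrow> x \<in> N (A - VN)"
    and N_fin: "\<And>x A. x \<in> N A \<Longrightarrow> x \<in> VN \<Longrightarrow> \<exists>F. finite F \<and> F \<subseteq> A \<and> x \<in> N F"
    and Nd_fin: "\<And>x A. x \<in> dual_cl E N A \<Longrightarrow> x \<notin> VN \<Longrightarrow> \<exists>F. finite F \<and> F \<subseteq> A \<and> x \<in> dual_cl E N F"
    and Md_in: "\<And>x A. x \<in> dual_cl E M A \<Longrightarrow> x \<in> VM \<Longrightarrow> x \<in> dual_cl E M (A \<inter> VM)"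
    and Md_out: "\<And>x A. x \<in> dual_cl E M A \<Longrightarrow> x \<notin> VM \<Longrightarrow> x \<in> dual_cl E M (A - VM)"
    and Md_fin: "\<And>x A. x \<in> dual_cl E M A \<Longrightarrow> x \<in> VM \<Longrightarrow> \<exists>F. finite F \<and> F \<subseteq> A \<and> x \<in> dual_cl E M F"
    and M_fin: "\<And>x A. x \<in> M A \<Longrightarrow> x \<notin> VM \<Longrightarrow> \<exists>F. finite F \<and> F \<subseteq> A \<and> x \<in> M F"
  shows "\<exists>I. I \<subseteq> E \<and> indep_wrt M I \<and> E \<subseteq> N I"
proof (cases "E = {}")
  case True
  then show ?thesis using M.indep_empty by blast
next
  case False
  interpret D: closure_pair "dual_cl E N" "dual_cl E M"
    by (intro closure_pair.intro M.dual N.dual)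
  define R where "R e I I' J J' \<longleftrightarrow> I \<subseteq> I' \<and> J \<subseteq> J' \<and> e \<in> I' \<union> J' \<and>
      (e \<in> J' \<longrightarrow> e \<in> VN \<longrightarrow> e \<in> N I') \<and> (e \<in> I' \<longrightarrow> e \<in> VM \<longrightarrow> e \<in> dual_cl E M J')" for e I I' J J'
  have step: "\<exists>I' J'. state E M N I' J' \<and> R e I I' J J'" if s: "state E M N I J" and e: "e \<in> E" for I J e
  proof -
    have "\<exists>I' J'. I \<subseteq> I' \<and> J \<subseteq> J' \<and> state E M N I' J' \<and> e \<in> I' \<union> J'"
    proof (cases "e \<in> I \<union> J")
      case True
      then show ?thesis using s by blast
    next
      case False
      then show ?thesis using state_place[OF E s, of e] e by blast
    qed
    then obtain I1 J1 where 1: "I \<subseteq> I1" "J \<subseteq> J1" "state E M N I1 J1" "e \<in> I1 \<union> J1" by blast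
    consider "e \<in> J1 \<and> e \<in> VN" | "e \<in> I1 \<and> e \<in> VM" | "\<not> (e \<in> J1 \<and> e \<in> VN) \<and> \<not> (e \<in> I1 \<and> e \<in> VM)"
      by blast
    then show ?thesis
    proof cases
      case a: 1
      obtain I' J' where 2: "I1 \<subseteq> I'" "J1 \<subseteq> J'" "state E M N I' J'" "e \<in> N I'"
        using state_span[OF E 1(3) _ _ N_in N_out N_fin, of e] a by blast
      have "I' \<inter> J' = {}" using 2(3) by (simp add: state_def)
      then have "e \<in> J'" "e \<notin> I'" using 2(2) a by auto
      then have "R e I I' J J'" using 1 2 by (auto simp: R_def)
      then show ?thesis using 2 by blast
    next
      case a: 2
      have sd: "state E (dual_cl E N) (dual_cl E M) J1 I1" using 1(3) state_dual by blast
      obtain J' I' where 2: "J1 \<subseteq> J'" "I1 \<subseteq> I'" "state E (dual_cl E N) (dual_cl E M) J' I'" "e \<in> dual_cl E M J'"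
        using D.state_span[OF E sd _ _ Md_in Md_out Md_fin, of e] a by blast
      have 3: "state E M N I' J'" using 2(3) state_dual by blast
      have "I' \<inter> J' = {}" using 3 by (simp add: state_def)
      then have "e \<in> I'" "e \<notin> J'" using 2(2) a by auto
      then have "R e I I' J J'" using 1 2 by (auto simp: R_def)
      then show ?thesis using 3 by blast
    next
      case a: 3
      then have "R e I I1 J J1" using 1 by (auto simp: R_def)
      then show ?thesis using 1 by blast
    qed
  qed
  let ?P = "\<lambda>(n::nat) (p::'a set \<times> 'a set). state E M N (fst p) (snd p)"
  let ?Q = "\<lambda>n p q. R (from_nat_into E n) (fst p) (fst q) (snd p) (snd q)"
  have "\<exists>\<sigma>. \<forall>n. ?P n (\<sigma> n) \<and> ?Q n (\<sigma> n) (\<sigma> (Suc n))"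
  proof (rule dependent_nat_choice)
    show "\<exists>p. ?P 0 p" using s0 by (intro exI[of _ "({}, {})"]) simp
    fix p :: "'a set \<times> 'a set" and n assume p: "?P n p"
    obtain I' J' where "state E M N I' J'" "R (from_nat_into E n) (fst p) I' (snd p) J'"
      using step[OF p from_nat_into[OF False]] by blast
    then show "\<exists>q. ?P (Suc n) q \<and> ?Q n p q" by (intro exI[of _ "(I', J')"]) simp
  qed
  then obtain \<sigma> where \<sigma>: "\<And>n. ?P n (\<sigma> n)" "\<And>n. ?Q n (\<sigma> n) (\<sigma> (Suc n))" by blast
  define In where "In n = fst (\<sigma> n)" for n
  define Jn where "Jn n = snd (\<sigma> n)" for n
  have st: "state E M N (In n) (Jn n)" and Rn: "R (from_nat_into E n) (In n) (In (Suc n)) (Jn n) (Jn (Suc n))" for n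
    using \<sigma> by (auto simp: In_def Jn_def)
  have Imono: "In n \<subseteq> In m" and Jmono: "Jn n \<subseteq> Jn m" if "n \<le> m" for n m
    using that lift_Suc_mono_le[of In n m] lift_Suc_mono_le[of Jn n m] Rn by (auto simp: R_def)
  define I where "I = (\<Union>n. In n)"
  define J where "J = (\<Union>n. Jn n)"
  have InE: "In n \<subseteq> E" and IJn: "In n \<inter> Jn n = {}" and iIn: "indep_wrt M (In n)"
    and JnN: "Jn n \<subseteq> N (E - Jn n)" for n
    using st[of n] by (simp_all add: state_def)
  have IE: "I \<subseteq> E" using InE by (auto simp: I_def)
  have IJ: "I \<inter> J = {}"
  proof -
    have "x \<notin> Jn m" if "x \<in> In n" for x n m
      using IJn[of "max n m"] Imono[of n "max n m"] Jmono[of m "max n m"] that by auto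
    then show ?thesis by (auto simp: I_def J_def)
  qed
  have settled: "e \<in> I \<union> J \<and> (e \<in> J \<longrightarrow> e \<in> VN \<longrightarrow> e \<in> N I) \<and> (e \<in> I \<longrightarrow> e \<in> VM \<longrightarrow> e \<in> dual_cl E M J)"
    if e: "e \<in> E" for e
  proof -
    obtain n where n: "from_nat_into E n = e" using from_nat_into_surj[OF E e] by blast
    have sub: "In (Suc n) \<subseteq> I" "Jn (Suc n) \<subseteq> J" by (auto simp: I_def J_def)
    have r: "e \<in> In (Suc n) \<union> Jn (Suc n)" "e \<in> Jn (Suc n) \<longrightarrow> e \<in> VN \<longrightarrow> e \<in> N (In (Suc n))"
      "e \<in> In (Suc n) \<longrightarrow> e \<in> VM \<longrightarrow> e \<in> dual_cl E M (Jn (Suc n))"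
      using Rn[of n] n by (auto simp: R_def)
    have "e \<in> J \<Longrightarrow> e \<in> Jn (Suc n)" "e \<in> I \<Longrightarrow> e \<in> In (Suc n)" using r(1) sub IJ by auto
    then show ?thesis using r sub N.mono[OF sub(1)] D.N.mono[OF sub(2)] by blast
  qed
  have finsub: "\<exists>n. F \<subseteq> A n" if "finite F" "F \<subseteq> (\<Union>n. A n)" "\<And>n m. n \<le> m \<Longrightarrow> A n \<subseteq> A m" for F and A :: "nat \<Rightarrow> 'a set"
    using that(1,2)
  proof (induction F)
    case (insert x F)
    then obtain n m where "F \<subseteq> A n" "x \<in> A m" by auto
    then have "insert x F \<subseteq> A (max n m)" using that(3)[of n "max n m"] that(3)[of m "max n m"] by auto
    then show ?case by blast
  qed simp
  have "indep_wrt M I" unfolding indep_wrt_def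
  proof (intro ballI notI)
    fix x assume x: "x \<in> I" "x \<in> M (I - {x})"
    show False
    proof (cases "x \<in> VM")
      case True
      then have "x \<in> dual_cl E M J" "x \<notin> J" using settled[of x] x IE IJ by blast+
      then have "x \<notin> M (E - J - {x})" by (auto simp: dual_cl_def)
      moreover have "I - {x} \<subseteq> E - J - {x}" using IE IJ by blast
      ultimately show False using M.in_mono[OF x(2)] by blast
    next
      case False
      then obtain F where F: "finite F" "F \<subseteq> I - {x}" "x \<in> M F" using M_fin[OF x(2)] by blast
      have "\<exists>n. insert x F \<subseteq> In n"
        by (rule finsub) (use F x Imono in \<open>auto simp: I_def\<close>)
      then obtain n where n: "insert x F \<subseteq> In n" by blast
      then have "F \<subseteq> In n - {x}" using F(2) by blast
      then have "x \<in> M (In n - {x})" by (rule M.in_mono[OF F(3)])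
      then show False using iIn[of n] n by (auto simp: indep_wrt_def)
    qed
  qed
  moreover have "E \<subseteq> N I"
  proof
    fix e assume e: "e \<in> E"
    show "e \<in> N I"
    proof (cases "e \<in> I \<or> e \<in> VN")
      case True
      then show ?thesis using settled[OF e] N.in_ext by blast
    next
      case False
      then have eJ: "e \<in> J" using settled[OF e] by blast
      show ?thesis
      proof (rule ccontr)
        \<comment> \<open>Then \<open>J - {e}\<close> spans \<open>e\<close> in the dual, and a
          finite part of it does so. This part lies in a single \<open>Jn n\<close> together with
          \<open>e\<close>, although \<open>Jn n\<close> is independent in the dual.\<close>
        assume n: "e \<notin> N I"
        have "E - (J - {e}) - {e} = I" using settled IJ IE eJ by blast
        then have "e \<in> dual_cl E N (J - {e})" using n e by (simp add: dual_cl_def)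
        then obtain F where F: "finite F" "F \<subseteq> J - {e}" "e \<in> dual_cl E N F" using Nd_fin False by metis
        have "\<exists>n. insert e F \<subseteq> Jn n"
          by (rule finsub) (use F eJ Jmono in \<open>auto simp: J_def\<close>)
        then obtain n where n: "insert e F \<subseteq> Jn n" by blast
        have "e \<in> N (E - Jn n)" using JnN[of n] n by auto
        then have "e \<in> N (E - F - {e})" by (rule N.in_mono) (use n in auto)
        moreover have "e \<notin> F" using F by blast
        ultimately show False using F(3) by (simp add: dual_cl_def)
      qed
    qed
  qed
  ultimately show ?thesis using IE by blast
qed

end

section \<open>From independent sets to closures\<close>

text \<open>Elements outside \<open>E\<close> are treated as coloops.\<close>

definition closure_of :: "'a set \<Rightarrow> 'a set set \<Rightarrow> 'a set \<Rightarrow> 'a set" where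
  "closure_of E \<I> X = X \<union> span E \<I> (X \<inter> E)"

locale indep_matroid =
  fixes E :: "'a set" and \<I> :: "'a set set"
  assumes mat: "matroid E \<I>"
begin

abbreviation basis_of :: "'a set \<Rightarrow> 'a set \<Rightarrow> bool" where
  "basis_of X B \<equiv> maximal_in {J\<in>\<I>. J \<subseteq> X} B"

abbreviation cl :: "'a set \<Rightarrow> 'a set" where
  "cl \<equiv> closure_of E \<I>"

lemma in_ground: "I \<in> \<I> \<Longrightarrow> I \<subseteq> E"
  using mat by (simp add: matroid_def)

lemma empty_in: "{} \<in> \<I>"
  using mat by (simp add: matroid_def)

lemma down: "I \<in> \<I> \<Longrightarrow> J \<subseteq> I \<Longrightarrow> J \<in> \<I>"
  using mat by (simp add: matroid_def)

lemma base_augment: "I \<in> \<I> \<Longrightarrow> maximal_in \<I> J \<Longrightarrow> \<not> maximal_in \<I> I \<Longrightarrow> \<exists>e\<in>J - I. insert e I \<in> \<I>"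
  using mat by (simp add: matroid_def)

lemma basis_extend: "X \<subseteq> E \<Longrightarrow> I \<in> \<I> \<Longrightarrow> I \<subseteq> X \<Longrightarrow> \<exists>B. I \<subseteq> B \<and> basis_of X B"
  using mat by (simp add: matroid_def)

lemma basis_ofD:
  assumes "basis_of X B"
  shows "B \<in> \<I>" "B \<subseteq> X" "\<And>Y. Y \<in> \<I> \<Longrightarrow> Y \<subseteq> X \<Longrightarrow> B \<subseteq> Y \<Longrightarrow> Y = B"
    "\<And>e. e \<in> X \<Longrightarrow> e \<notin> B \<Longrightarrow> insert e B \<notin> \<I>"
proof -
  show 1: "B \<in> \<I>" "B \<subseteq> X" using assms by (auto simp: maximal_in_def)
  show 2: "\<And>Y. Y \<in> \<I> \<Longrightarrow> Y \<subseteq> X \<Longrightarrow> B \<subseteq> Y \<Longrightarrow> Y = B" using assms by (auto simp: maximal_in_def)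
  show "insert e B \<notin> \<I>" if "e \<in> X" "e \<notin> B" for e using 2[of "insert e B"] 1 that by auto
qed

lemma basis_ofI:
  assumes "B \<in> \<I>" "B \<subseteq> X" "\<And>e. e \<in> X \<Longrightarrow> e \<notin> B \<Longrightarrow> insert e B \<notin> \<I>"
  shows "basis_of X B"
  unfolding maximal_in_def
proof (intro conjI ballI impI)
  show "B \<in> {J \<in> \<I>. J \<subseteq> X}" using assms by simp
  fix Y assume Y: "Y \<in> {J \<in> \<I>. J \<subseteq> X}" "B \<subseteq> Y"
  show "Y = B"
  proof (rule ccontr)
    assume "Y \<noteq> B"
    then obtain e where e: "e \<in> Y" "e \<notin> B" using Y by blast
    then have "insert e B \<in> \<I>" using Y down[of Y "insert e B"] by auto
    then show False using assms(3) e Y by auto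
  qed
qed

lemma basis_of_ground: "basis_of E B \<longleftrightarrow> maximal_in \<I> B"
proof -
  have "{J\<in>\<I>. J \<subseteq> E} = \<I>" using in_ground by blast
  then show ?thesis by simp
qed

lemma basis_of_spanning_is_base:
  assumes "maximal_in \<I> B" "B \<subseteq> A" "basis_of A D"
  shows "maximal_in \<I> D"
proof (rule ccontr)
  assume "\<not> maximal_in \<I> D"
  then obtain e where "e \<in> B - D" "insert e D \<in> \<I>"
    using base_augment[OF basis_ofD(1)[OF assms(3)] assms(1)] by blast
  then show False using basis_ofD(4)[OF assms(3), of e] assms(2) by blast
qed

text \<open>The axiom speaks only of bases of the whole matroid, and this carries it over to
  \<open>X\<close>. If \<open>J\<close> offered no element to \<open>I\<close>, a base
  \<open>B'\<close> through \<open>I\<close> inside \<open>I \<union> B\<close> would avoid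
  \<open>J - I\<close>; adding an \<open>f\<close> from elsewhere in \<open>X\<close> then expels
  some \<open>g\<close> that lies outside \<open>X\<close>.\<close>

lemma augment_in:
  assumes X: "X \<subseteq> E" and I: "I \<in> \<I>" "I \<subseteq> X" "\<not> basis_of X I" and J: "basis_of X J"
  shows "\<exists>e\<in>J - I. insert e I \<in> \<I>"
proof (rule ccontr)
  assume no: "\<not> (\<exists>e\<in>J - I. insert e I \<in> \<I>)"
  note Jd = basis_ofD[OF J]
  obtain B where B: "J \<subseteq> B" "maximal_in \<I> B"
    using basis_extend[OF order_refl Jd(1) in_ground[OF Jd(1)]] basis_of_ground by blast
  have BI: "B \<in> \<I>" using B by (simp add: maximal_in_def)
  have BX: "B \<inter> X = J" by (rule Jd(3)) (use down[OF BI, of "B \<inter> X"] B Jd(2) in auto)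
  obtain B' where B': "I \<subseteq> B'" "basis_of (I \<union> B) B'"
    using basis_extend[of "I \<union> B" I] I in_ground BI by blast
  have B'm: "maximal_in \<I> B'" by (rule basis_of_spanning_is_base[OF B(2) _ B'(2)]) auto
  note B'd = basis_ofD[OF B'(2)]
  have disj: "B' \<inter> (J - I) = {}"
  proof (rule ccontr)
    assume "B' \<inter> (J - I) \<noteq> {}"
    then obtain e where "e \<in> B'" "e \<in> J - I" by blast
    then show False using no down[OF B'd(1), of "insert e I"] B'(1) by blast
  qed
  obtain f where f: "f \<in> X" "f \<notin> I" "insert f I \<in> \<I>" using basis_ofI[OF I(1,2)] I(3) by blast
  have fB': "f \<notin> B'" using f B'd(2) BX disj by blast
  have "insert f B' \<subseteq> E" using f X in_ground[OF B'd(1)] by blast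
  then obtain B'' where B'': "insert f I \<subseteq> B''" "basis_of (insert f B') B''"
    using basis_extend[of "insert f B'" "insert f I"] f(3) B'(1) by blast
  note B''d = basis_ofD[OF B''(2)]
  have B''m: "maximal_in \<I> B''" by (rule basis_of_spanning_is_base[OF B'm _ B''(2)]) auto
  have "\<not> B' \<subseteq> B''"
    using B'm B''d(1) B''(1) fB' unfolding maximal_in_def by blast
  then obtain g where g: "g \<in> B'" "g \<notin> B''" by blast
  have gB: "g \<in> B" "g \<notin> J" using g B''(1) B'd(2) disj by blast+
  \<comment> \<open>\<open>?K\<close> lies in \<open>B\<close> without \<open>g\<close>, so it is
    not a base. It contains all of \<open>B''\<close> outside \<open>X\<close>, so an element of
    \<open>B''\<close> that augments it lies in \<open>X\<close> and would enlarge \<open>J\<close>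
    there.\<close>
  let ?K = "J \<union> (B'' - X)"
  have KB: "?K \<subseteq> B" using B(1) B''d(2) B'd(2) f(1) I(2) by blast
  have "?K \<in> \<I>" using down[OF BI KB] .
  moreover have "\<not> maximal_in \<I> ?K" using KB BI g gB unfolding maximal_in_def by blast
  ultimately obtain e where e: "e \<in> B'' - ?K" "insert e ?K \<in> \<I>"
    using base_augment[OF _ B''m] by blast
  then have "insert e J \<in> \<I>" "e \<in> X" "e \<notin> J" using down[OF e(2), of "insert e J"] by blast+
  then show False using Jd(4) by blast
qed

text \<open>Any basis of \<open>X \<inter> E\<close> may serve as \<open>B\<close>, which reduces
  the closure axioms to statements about bases. From left to right, \<open>augment_in\<close>
  compares \<open>B\<close> with a basis that contains \<open>C - {e}\<close>.\<close>

lemma mem_closure: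
  assumes B: "basis_of (X \<inter> E) B" and e: "e \<notin> X"
  shows "e \<in> cl X \<longleftrightarrow> e \<in> E \<and> insert e B \<notin> \<I>"
proof
  note Bd = basis_ofD[OF B]
  assume "e \<in> cl X"
  then obtain C where C: "circuit E \<I> C" "e \<in> C" "C - {e} \<subseteq> X \<inter> E" using e by (auto simp: closure_of_def span_def)
  have CI: "C - {e} \<in> \<I>" "C \<notin> \<I>" "e \<in> E" using C by (auto simp: circuit_def)
  obtain D where D: "C - {e} \<subseteq> D" "basis_of (X \<inter> E) D" using basis_extend[OF _ CI(1) C(3)] by blast
  note Dd = basis_ofD[OF D(2)]
  have "insert e D \<notin> \<I>" using CI(2) down[of "insert e D" C] D(1) by blast
  then have De: "basis_of (insert e (X \<inter> E)) D" using Dd by (intro basis_ofI) auto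
  show "e \<in> E \<and> insert e B \<notin> \<I>"
  proof (intro conjI notI)
    show "e \<in> E" by fact
    assume Be: "insert e B \<in> \<I>"
    have eB: "e \<notin> B" using Bd(2) e by blast
    have nb: "\<not> basis_of (insert e (X \<inter> E)) B"
    proof
      assume "basis_of (insert e (X \<inter> E)) B"
      from basis_ofD(4)[OF this, of e] show False using Be eB by blast
    qed
    have "\<exists>d\<in>D - B. insert d B \<in> \<I>"
      by (rule augment_in[OF _ Bd(1) _ nb De]) (use Bd(2) \<open>e \<in> E\<close> in auto)
    then show False using Bd(4) Dd(2) by blast
  qed
next
  note Bd = basis_ofD[OF B]
  assume a: "e \<in> E \<and> insert e B \<notin> \<I>"
  \<comment> \<open>The fundamental circuit of \<open>e\<close>: those elements of \<open>B\<close>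
    that \<open>e\<close> can replace.\<close>
  define C where "C = insert e {y\<in>B. insert e (B - {y}) \<in> \<I>}"
  have eB: "e \<notin> B" using Bd(2) e by blast
  have BE: "B \<subseteq> E" using in_ground Bd(1) by blast
  have BB: "basis_of (insert e B) B" by (rule basis_ofI) (use Bd(1) a in auto)
  have CB: "C \<subseteq> insert e B" by (auto simp: C_def)
  have "C \<notin> \<I>"
  proof
    assume "C \<in> \<I>"
    then obtain D where D: "C \<subseteq> D" "basis_of (insert e B) D"
      using basis_extend[of "insert e B" C] CB a BE by blast
    note Dd = basis_ofD[OF D(2)]
    have "D \<noteq> insert e B" using Dd(1) a by blast
    moreover have "e \<in> D" using D(1) by (auto simp: C_def)
    ultimately obtain y where y: "y \<in> B" "y \<notin> D" using Dd(2) by blast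
    have nb: "\<not> basis_of (insert e B) (B - {y})"
    proof
      assume "basis_of (insert e B) (B - {y})"
      from basis_ofD(4)[OF this, of y] show False using y(1) Bd(1) by (auto simp: insert_absorb)
    qed
    have "\<exists>d\<in>D - (B - {y}). insert d (B - {y}) \<in> \<I>"
      by (rule augment_in[OF _ _ _ nb D(2)]) (use a BE down[OF Bd(1)] in auto)
    then have "insert e (B - {y}) \<in> \<I>" using Dd(2) y by auto
    then show False using y D(1) by (auto simp: C_def)
  qed
  moreover have "D \<in> \<I>" if D: "D \<subset> C" for D
  proof (cases "e \<in> D")
    case True
    then obtain y where y: "y \<in> C" "y \<notin> D" "y \<noteq> e" using D by blast
    then have "insert e (B - {y}) \<in> \<I>" by (auto simp: C_def)
    then show ?thesis by (rule down) (use D CB y in blast)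
  next
    case False
    then show ?thesis using down[OF Bd(1), of D] D CB by blast
  qed
  ultimately have "circuit E \<I> C" using CB BE a by (auto simp: circuit_def)
  moreover have "C - {e} \<subseteq> X \<inter> E" using CB Bd(2) by blast
  moreover have "e \<in> C" by (simp add: C_def)
  ultimately show "e \<in> cl X" by (auto simp: closure_of_def span_def)
qed

lemma basis_exists: "\<exists>B. basis_of (X \<inter> E) B"
  using basis_extend[OF _ empty_in, of "X \<inter> E"] by blast

lemma basis_of_insert:
  assumes "basis_of X B" "insert x B \<in> \<I>" "x \<notin> X"
  shows "basis_of (insert x X) (insert x B)"
proof (rule basis_ofI)
  note Bd = basis_ofD[OF assms(1)]
  show "insert x B \<in> \<I>" "insert x B \<subseteq> insert x X" using assms Bd(2) by auto
  fix e assume e: "e \<in> insert x X" "e \<notin> insert x B"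
  then have "insert e B \<notin> \<I>" using Bd(4) by blast
  then show "insert e (insert x B) \<notin> \<I>" using down[of "insert e (insert x B)" "insert e B"] by blast
qed

lemma indep_closure_iff: "indep_wrt cl A \<longleftrightarrow> A \<inter> E \<in> \<I>"
proof
  assume i: "indep_wrt cl A"
  show "A \<inter> E \<in> \<I>"
  proof (rule ccontr)
    assume n: "A \<inter> E \<notin> \<I>"
    obtain B where B: "basis_of (A \<inter> E) B" using basis_exists by blast
    note Bd = basis_ofD[OF B]
    have "B \<noteq> A \<inter> E" using Bd(1) n by auto
    then obtain x where x: "x \<in> A \<inter> E" "x \<notin> B" using Bd(2) by blast
    have "basis_of ((A - {x}) \<inter> E) B" by (rule basis_ofI) (use Bd x in auto)
    then have "x \<in> cl (A - {x})" using mem_closure[of "A - {x}" B x] Bd(4) x by blast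
    then show False using i x by (auto simp: indep_wrt_def)
  qed
next
  assume A: "A \<inter> E \<in> \<I>"
  show "indep_wrt cl A" unfolding indep_wrt_def
  proof (intro ballI notI)
    fix x assume x: "x \<in> A" "x \<in> cl (A - {x})"
    have "basis_of ((A - {x}) \<inter> E) ((A - {x}) \<inter> E)"
      by (rule basis_ofI) (use down[OF A, of "(A - {x}) \<inter> E"] in auto)
    from mem_closure[OF this, of x] x have "x \<in> E" "insert x ((A - {x}) \<inter> E) \<notin> \<I>" by auto
    moreover have "insert x ((A - {x}) \<inter> E) = A \<inter> E" using x \<open>x \<in> E\<close> by auto
    ultimately show False using A by simp
  qed
qed

lemma closure_matroid: "closure_matroid cl"
proof
  fix A show "A \<subseteq> cl A" by (simp add: closure_of_def)
next
  fix A B :: "'a set" assume "A \<subseteq> B"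
  then show "cl A \<subseteq> cl B" unfolding closure_of_def span_def by blast
next
  fix X
  obtain B where B: "basis_of (X \<inter> E) B" using basis_exists by blast
  note Bd = basis_ofD[OF B]
  have XX: "X \<subseteq> cl X" by (simp add: closure_of_def)
  have B2: "basis_of (cl X \<inter> E) B"
  proof (rule basis_ofI)
    show "B \<in> \<I>" "B \<subseteq> cl X \<inter> E" using Bd(1,2) XX by auto
    fix e assume "e \<in> cl X \<inter> E" "e \<notin> B"
    then show "insert e B \<notin> \<I>" using Bd(4)[of e] mem_closure[OF B, of e] by blast
  qed
  show "cl (cl X) \<subseteq> cl X"
  proof
    fix e assume e: "e \<in> cl (cl X)"
    show "e \<in> cl X"
    proof (rule ccontr)
      assume n: "e \<notin> cl X"
      then show False using e mem_closure[OF B2 n] mem_closure[OF B, of e] XX by blast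
    qed
  qed
next
  fix x y A assume y: "y \<in> cl (insert x A)" "y \<notin> cl A"
  have Acl: "A \<subseteq> cl A" by (simp add: closure_of_def)
  show "x \<in> cl (insert y A)"
  proof (cases "y = x")
    case True
    then show ?thesis by (simp add: closure_of_def)
  next
    case False
    have yA: "y \<notin> A" "y \<notin> insert x A" using y(2) Acl False by auto
    have xA: "x \<notin> A" using y by (metis insert_absorb)
    have xE: "x \<in> E"
    proof (rule ccontr)
      assume "x \<notin> E"
      then have "insert x A \<inter> E = A \<inter> E" by auto
      then show False using y False by (auto simp: closure_of_def)
    qed
    obtain B where B: "basis_of (A \<inter> E) B" using basis_exists by blast
    note Bd = basis_ofD[OF B]
    obtain B' where B': "basis_of (insert x A \<inter> E) B'" using basis_exists by blast
    have yE: "y \<in> E" using mem_closure[OF B' yA(2)] y(1) by blast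
    then have yB: "insert y B \<in> \<I>" using mem_closure[OF B yA(1)] y(2) by blast
    have e1: "insert x A \<inter> E = insert x (A \<inter> E)" using xE by auto
    have e2: "insert y A \<inter> E = insert y (A \<inter> E)" using yE by auto
    have xB: "insert x B \<in> \<I>"
    proof (rule ccontr)
      assume n: "insert x B \<notin> \<I>"
      have "basis_of (insert x A \<inter> E) B" unfolding e1 by (rule basis_ofI) (use Bd n in auto)
      then show False using mem_closure[OF _ yA(2)] y(1) yB by blast
    qed
    have "basis_of (insert x A \<inter> E) (insert x B)" unfolding e1
      by (rule basis_of_insert[OF B xB]) (use xA in auto)
    then have n: "insert y (insert x B) \<notin> \<I>" using mem_closure[OF _ yA(2)] y(1) by blast
    have b: "basis_of (insert y A \<inter> E) (insert y B)" unfolding e2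
      by (rule basis_of_insert[OF B yB]) (use yA in auto)
    have "x \<notin> insert y A" using xA False by auto
    from mem_closure[OF b this] show ?thesis using xE n by (simp add: insert_commute)
  qed
next
  fix A S assume A: "indep_wrt cl A" "A \<subseteq> S"
  then have "A \<inter> E \<in> \<I>" using indep_closure_iff by blast
  then obtain B where B: "A \<inter> E \<subseteq> B" "basis_of (S \<inter> E) B"
    using basis_extend[of "S \<inter> E" "A \<inter> E"] A(2) by blast
  note Bd = basis_ofD[OF B(2)]
  have e: "(B \<union> (S - E)) \<inter> E = B" using Bd(2) by auto
  have b: "basis_of ((B \<union> (S - E)) \<inter> E) B" unfolding e by (rule basis_ofI) (use Bd(1) in auto)
  show "\<exists>B. A \<subseteq> B \<and> B \<subseteq> S \<and> indep_wrt cl B \<and> S \<subseteq> cl B"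
  proof (intro exI[of _ "B \<union> (S - E)"] conjI)
    show "A \<subseteq> B \<union> (S - E)" "B \<union> (S - E) \<subseteq> S" using A B Bd(2) by auto
    show "indep_wrt cl (B \<union> (S - E))" unfolding indep_closure_iff e by (rule Bd(1))
    show "S \<subseteq> cl (B \<union> (S - E))"
    proof
      fix s assume s: "s \<in> S"
      show "s \<in> cl (B \<union> (S - E))"
      proof (cases "s \<in> B \<union> (S - E)")
        case True
        then show ?thesis by (simp add: closure_of_def)
      next
        case False
        then show ?thesis using mem_closure[OF b False] Bd(4) s by blast
      qed
    qed
  qed
qed

text \<open>Both sides express that \<open>E - K\<close> contains a base.\<close>

lemma indep_dual_iff:
  assumes K: "K \<subseteq> E"
  shows "indep_wrt (dual_cl E cl) K \<longleftrightarrow> K \<in> dual_indep E \<I>"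
proof -
  have "k \<in> dual_cl E cl (K - {k}) \<longleftrightarrow> k \<notin> cl (E - K)" if "k \<in> K" for k
  proof -
    have "E - (K - {k}) - {k} = E - K" using that by auto
    then show ?thesis using that K by (auto simp: dual_cl_def)
  qed
  then have i: "indep_wrt (dual_cl E cl) K \<longleftrightarrow> K \<subseteq> cl (E - K)" by (auto simp: indep_wrt_def)
  have e: "(E - K) \<inter> E = E - K" by auto
  show ?thesis unfolding i
  proof
    assume Kc: "K \<subseteq> cl (E - K)"
    obtain B where B: "basis_of ((E - K) \<inter> E) B" using basis_exists by blast
    note Bd = basis_ofD[OF B]
    have "basis_of E B"
    proof (rule basis_ofI)
      show "B \<in> \<I>" "B \<subseteq> E" using Bd by auto
      fix x assume x: "x \<in> E" "x \<notin> B"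
      show "insert x B \<notin> \<I>"
      proof (cases "x \<in> K")
        case True
        then show ?thesis using mem_closure[OF B, of x] Kc by blast
      next
        case False
        then show ?thesis using Bd(4) x by blast
      qed
    qed
    then have "B \<in> bases \<I>" using basis_of_ground by (simp add: bases_def)
    moreover have "K \<subseteq> E - B" using K Bd(2) by blast
    ultimately show "K \<in> dual_indep E \<I>" by (auto simp: dual_indep_def)
  next
    assume "K \<in> dual_indep E \<I>"
    then obtain B where "maximal_in \<I> B" and KB: "K \<subseteq> E - B" by (auto simp: dual_indep_def bases_def)
    then have "basis_of E B" using basis_of_ground by blast
    note Bd = basis_ofD[OF this]
    have b: "basis_of ((E - K) \<inter> E) B" by (rule basis_ofI) (use Bd(1,2,4) KB in auto)
    show "K \<subseteq> cl (E - K)"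
    proof
      fix k assume k: "k \<in> K"
      then have "insert k B \<notin> \<I>" using Bd(4)[of k] KB by blast
      then show "k \<in> cl (E - K)" using mem_closure[OF b, of k] k K by blast
    qed
  qed
qed

text \<open>In a dual basis \<open>B\<close> of \<open>A\<close>, the elements that are
  indispensable for spanning \<open>x\<close> form together with \<open>x\<close> a circuit of the
  dual, which is finite by assumption.\<close>

lemma cofinitary_dual_finite:
  assumes co: "cofinitary E \<I>" and x: "x \<in> dual_cl E cl A"
  shows "\<exists>F. finite F \<and> F \<subseteq> A \<and> x \<in> dual_cl E cl F"
proof (cases "x \<in> A")
  case True
  then show ?thesis by (intro exI[of _ "{x}"]) (simp add: dual_cl_def)
next
  case False
  let ?D = "dual_cl E cl"
  interpret C: closure_matroid cl by (rule closure_matroid)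
  interpret D: closure_matroid ?D by (rule C.dual)
  obtain B where B: "B \<subseteq> A" "indep_wrt ?D B" "A \<subseteq> ?D B" using D.base[OF D.indep_empty, of A] by blast
  have xB: "x \<in> ?D B" by (rule D.in_trans[OF x B(3)])
  have xE: "x \<in> E" using x False by (auto simp: dual_cl_def)
  have xnB: "x \<notin> B" using B(1) False by blast
  define C0 where "C0 = {y\<in>B. x \<notin> ?D (B - {y})}"
  have "x \<in> ?D (B - (B - C0))" by (rule D.removable[OF B(2) xB]) (auto simp: C0_def)
  moreover have "B - (B - C0) = C0" by (auto simp: C0_def)
  ultimately have xC: "x \<in> ?D C0" by simp
  have C0E: "C0 \<subseteq> E"
  proof
    fix y assume y: "y \<in> C0"
    show "y \<in> E"
    proof (rule ccontr)
      assume "y \<notin> E"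
      then have "E - (B - {y}) = E - B" by auto
      then have "x \<in> ?D (B - {y})" using xB xnB xE by (auto simp: dual_cl_def)
      then show False using y by (simp add: C0_def)
    qed
  qed
  have CE: "insert x C0 \<subseteq> E" using C0E xE by auto
  have "circuit E (dual_indep E \<I>) (insert x C0)"
    unfolding circuit_def
  proof (intro conjI allI impI)
    show "insert x C0 \<subseteq> E" by (rule CE)
    have "\<not> indep_wrt ?D (insert x C0)"
    proof
      assume "indep_wrt ?D (insert x C0)"
      moreover have "insert x C0 - {x} = C0" using xnB by (auto simp: C0_def)
      ultimately show False using xC by (auto simp: indep_wrt_def)
    qed
    then show "insert x C0 \<notin> dual_indep E \<I>" using indep_dual_iff[OF CE] by blast
    fix K assume K: "K \<subset> insert x C0"
    have "indep_wrt ?D K"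
    proof (cases "x \<in> K")
      case False
      then have "K \<subseteq> B" using K by (auto simp: C0_def)
      then show ?thesis by (rule D.indep_subset[OF B(2)])
    next
      case True
      then obtain y where y: "y \<in> C0" "y \<notin> K" using K by blast
      have "indep_wrt ?D (insert x (B - {y}))"
        by (rule D.indep_insert[OF D.indep_subset[OF B(2)]]) (use y in \<open>auto simp: C0_def\<close>)
      then show ?thesis by (rule D.indep_subset) (use K y in \<open>auto simp: C0_def\<close>)
    qed
    then show "K \<in> dual_indep E \<I>" using indep_dual_iff[of K] K CE by blast
  qed
  then have "finite (insert x C0)" using co by (simp only: cofinitary_def finitary_def)
  moreover have "C0 \<subseteq> A" using B(1) by (auto simp: C0_def)
  ultimately show ?thesis using xC by auto
qed

end

text \<open>A circuit meeting both summands would have independent traces on both, and their union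
  would be independent. So every circuit lies in one summand, and the cofinitary one serves as
  \<open>V\<close>; elements outside \<open>E\<close> lie in no circuit and may be counted on the
  finitary side.\<close>

lemma fin_plus_cofin_closure:
  assumes "fin_plus_cofin E \<I>"
  obtains V where
    "\<And>x A. x \<in> closure_of E \<I> A \<Longrightarrow> x \<notin> V \<Longrightarrow> \<exists>F. finite F \<and> F \<subseteq> A - V \<and> x \<in> closure_of E \<I> F"
    "\<And>x A. x \<in> closure_of E \<I> A \<Longrightarrow> x \<in> V \<Longrightarrow> x \<in> closure_of E \<I> (A \<inter> V)"
    "\<And>x A. x \<in> dual_cl E (closure_of E \<I>) A \<Longrightarrow> x \<in> V \<Longrightarrow>
      \<exists>F. finite F \<and> F \<subseteq> A \<and> x \<in> dual_cl E (closure_of E \<I>) F"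
proof -
  obtain E1 E2 \<I>1 \<I>2 where d: "E1 \<inter> E2 = {}" "E1 \<union> E2 = E" "matroid E1 \<I>1" "finitary E1 \<I>1"
      "matroid E2 \<I>2" "cofinitary E2 \<I>2" "\<I> = {I1 \<union> I2 | I1 I2. I1 \<in> \<I>1 \<and> I2 \<in> \<I>2}"
    using assms by (auto simp: fin_plus_cofin_def)
  interpret A1: indep_matroid E1 \<I>1 by unfold_locales (rule d(3))
  interpret A2: indep_matroid E2 \<I>2 by unfold_locales (rule d(5))
  have in1: "K \<in> \<I> \<longleftrightarrow> K \<in> \<I>1" if K: "K \<subseteq> E1" for K
  proof
    assume "K \<in> \<I>"
    then obtain I1 I2 where i: "K = I1 \<union> I2" "I1 \<in> \<I>1" "I2 \<in> \<I>2" using d(7) by blast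
    then have "I2 = {}" using A2.in_ground[OF i(3)] K d(1) by blast
    then show "K \<in> \<I>1" using i by simp
  next
    assume "K \<in> \<I>1"
    then show "K \<in> \<I>" using d(7) A2.empty_in by blast
  qed
  have in2: "K \<in> \<I> \<longleftrightarrow> K \<in> \<I>2" if K: "K \<subseteq> E2" for K
  proof
    assume "K \<in> \<I>"
    then obtain I1 I2 where i: "K = I1 \<union> I2" "I1 \<in> \<I>1" "I2 \<in> \<I>2" using d(7) by blast
    then have "I1 = {}" using A1.in_ground[OF i(2)] K d(1) by blast
    then show "K \<in> \<I>2" using i by simp
  next
    assume "K \<in> \<I>2"
    then show "K \<in> \<I>" using d(7) A1.empty_in by blast
  qed
  have side: "C \<subseteq> E1 \<or> C \<subseteq> E2" if C: "circuit E \<I> C" for C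
  proof (rule ccontr)
    assume n: "\<not> (C \<subseteq> E1 \<or> C \<subseteq> E2)"
    have CE: "C \<subseteq> E" "C \<notin> \<I>" using C by (auto simp: circuit_def)
    have "C \<inter> E1 \<subset> C" "C \<inter> E2 \<subset> C" using n by auto
    then have "C \<inter> E1 \<in> \<I>" "C \<inter> E2 \<in> \<I>" using C by (auto simp: circuit_def)
    then have "C \<inter> E1 \<in> \<I>1" "C \<inter> E2 \<in> \<I>2" using in1 in2 by auto
    moreover have "C = (C \<inter> E1) \<union> (C \<inter> E2)" using CE d(2) by auto
    ultimately show False using CE(2) d(7) by blast
  qed
  have c1: "circuit E1 \<I>1 C" if "circuit E \<I> C" "C \<subseteq> E1" for C
    using that in1[of C] in1 by (auto simp: circuit_def)
  have c2: "circuit E2 \<I>2 C \<longleftrightarrow> circuit E \<I> C" if C: "C \<subseteq> E2" for C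
  proof -
    have "D \<in> \<I> \<longleftrightarrow> D \<in> \<I>2" if "D \<subset> C" for D using in2[of D] that C by blast
    then show ?thesis using in2[OF C] C d(2) by (auto simp: circuit_def)
  qed
  let ?c = "closure_of E \<I>" and ?c2 = "closure_of E2 \<I>2"
  have getC: "\<exists>C. circuit E \<I> C \<and> x \<in> C \<and> C - {x} \<subseteq> A" if "x \<in> ?c A" "x \<notin> A" for x A
    using that by (auto simp: closure_of_def span_def)
  have putC: "x \<in> ?c A" if "circuit E \<I> C" "x \<in> C" "C - {x} \<subseteq> A" for x A C
  proof -
    have "C - {x} \<subseteq> A \<inter> E" using that(1,3) by (auto simp: circuit_def)
    then show ?thesis unfolding closure_of_def span_def using that(1,2) by blast
  qed
  have fin: "\<exists>F. finite F \<and> F \<subseteq> A - E2 \<and> x \<in> ?c F" if x: "x \<in> ?c A" "x \<notin> E2" for x A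
  proof (cases "x \<in> A")
    case True
    then show ?thesis using x by (intro exI[of _ "{x}"]) (auto simp: closure_of_def)
  next
    case False
    then obtain C where C: "circuit E \<I> C" "x \<in> C" "C - {x} \<subseteq> A" using getC[OF x(1)] by blast
    then have CE: "C \<subseteq> E1" using side[OF C(1)] x(2) by blast
    then have "finite C" using c1[OF C(1)] d(4) by (auto simp: finitary_def)
    moreover have "C - {x} \<subseteq> A - E2" using C(3) CE d(1) by blast
    ultimately show ?thesis using putC[OF C(1,2) order_refl] by blast
  qed
  have into: "x \<in> ?c (A \<inter> E2)" if x: "x \<in> ?c A" "x \<in> E2" for x A
  proof (cases "x \<in> A")
    case True
    then show ?thesis using x by (auto simp: closure_of_def)
  next
    case False
    then obtain C where C: "circuit E \<I> C" "x \<in> C" "C - {x} \<subseteq> A" using getC[OF x(1)] by blast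
    then have "C \<subseteq> E2" using side[OF C(1)] x(2) d(1) by blast
    then show ?thesis using putC[OF C(1,2)] C(3) by blast
  qed
  have c2c: "x \<in> ?c2 A \<longleftrightarrow> x \<in> ?c A" if x: "x \<in> E2" for x A
  proof (cases "x \<in> A")
    case True
    then show ?thesis by (simp add: closure_of_def)
  next
    case xA: False
    show ?thesis
    proof
      assume "x \<in> ?c2 A"
      then obtain C where C: "circuit E2 \<I>2 C" "x \<in> C" "C - {x} \<subseteq> A" using xA by (auto simp: closure_of_def span_def)
      then have "C \<subseteq> E2" by (simp add: circuit_def)
      then show "x \<in> ?c A" using c2 C putC by blast
    next
      assume "x \<in> ?c A"
      then obtain C where C: "circuit E \<I> C" "x \<in> C" "C - {x} \<subseteq> A" using getC[OF _ xA] by blast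
      then have CE: "C \<subseteq> E2" using side[OF C(1)] x d(1) by blast
      then have "circuit E2 \<I>2 C" using c2 C by blast
      moreover have "C - {x} \<subseteq> A \<inter> E2" using C CE by blast
      ultimately show "x \<in> ?c2 A" using C(2) by (auto simp: closure_of_def span_def)
    qed
  qed
  have dd: "x \<in> dual_cl E2 ?c2 A \<longleftrightarrow> x \<in> dual_cl E ?c A" if x: "x \<in> E2" for x A
  proof -
    have "x \<in> ?c (E2 - A - {x}) \<longleftrightarrow> x \<in> ?c (E - A - {x})"
    proof
      assume "x \<in> ?c (E - A - {x})"
      then have "x \<in> ?c ((E - A - {x}) \<inter> E2)" using into x by blast
      moreover have "(E - A - {x}) \<inter> E2 = E2 - A - {x}" using d(2) by auto
      ultimately show "x \<in> ?c (E2 - A - {x})" by simp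
    next
      assume "x \<in> ?c (E2 - A - {x})"
      then show "x \<in> ?c (E - A - {x})" using d(2) unfolding closure_of_def span_def by blast
    qed
    then show ?thesis using x d(2) c2c[OF x] by (auto simp: dual_cl_def)
  qed
  have "\<exists>F. finite F \<and> F \<subseteq> A \<and> x \<in> dual_cl E ?c F" if x: "x \<in> dual_cl E ?c A" "x \<in> E2" for x A
    using A2.cofinitary_dual_finite[OF d(6), of x A] x dd by blast
  then show thesis using that[of E2] fin into by blast
qed

section \<open>The partition theorem\<close>

lemma closure_of_eq_span: "X \<subseteq> E \<Longrightarrow> closure_of E \<I> X = span E \<I> X"
  by (auto simp: closure_of_def span_def Int_absorb2)

theorem mainTheorem2:
  fixes E :: "'a set" and \<I>M \<I>N :: "'a set set"
  assumes "countable E"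
    and "matroid E \<I>M" and "matroid E \<I>N"
    and "fin_plus_cofin E \<I>M" and "fin_plus_cofin E \<I>N"
  shows "\<exists>I EM EN. I \<in> \<I>M \<and> I \<in> \<I>N \<and>
           EM \<inter> EN = {} \<and> EM \<union> EN = E \<and>
           EM \<subseteq> span E \<I>M (I \<inter> EM) \<and>
           EN \<subseteq> span E \<I>N (I \<inter> EN)"
proof -
  interpret PM: indep_matroid E \<I>M by unfold_locales (rule assms)
  interpret PN: indep_matroid E \<I>N by unfold_locales (rule assms)
  define M where "M = closure_of E \<I>M"
  define N where "N = closure_of E \<I>N"
  interpret M: closure_matroid M unfolding M_def by (rule PM.closure_matroid)
  interpret N: closure_matroid N unfolding N_def by (rule PN.closure_matroid)
  interpret P: closure_pair M N by unfold_locales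
  obtain V where V: "\<And>x A. x \<in> M A \<Longrightarrow> x \<notin> V \<Longrightarrow> \<exists>F. finite F \<and> F \<subseteq> A - V \<and> x \<in> M F"
    "\<And>x A. x \<in> M A \<Longrightarrow> x \<in> V \<Longrightarrow> x \<in> M (A \<inter> V)"
    "\<And>x A. x \<in> dual_cl E M A \<Longrightarrow> x \<in> V \<Longrightarrow> \<exists>F. finite F \<and> F \<subseteq> A \<and> x \<in> dual_cl E M F"
    using fin_plus_cofin_closure[OF assms(4)] unfolding M_def by metis
  obtain V' where V': "\<And>x A. x \<in> N A \<Longrightarrow> x \<notin> V' \<Longrightarrow> \<exists>F. finite F \<and> F \<subseteq> A - V' \<and> x \<in> N F"
    "\<And>x A. x \<in> N A \<Longrightarrow> x \<in> V' \<Longrightarrow> x \<in> N (A \<inter> V')"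
    "\<And>x A. x \<in> dual_cl E N A \<Longrightarrow> x \<in> V' \<Longrightarrow> \<exists>F. finite F \<and> F \<subseteq> A \<and> x \<in> dual_cl E N F"
    using fin_plus_cofin_closure[OF assms(5)] unfolding N_def by metis
  obtain EM Y where Y: "wave E M N {} EM Y" "\<And>W X. wave E M N {} W X \<Longrightarrow> W \<subseteq> EM"
    using P.wave_max[OF assms(1), of "{}"] by blast
  obtain X0 where X0: "wave E M N {} EM X0" "indep_wrt M ({} \<union> X0)"
    using P.wave_shrink[OF Y(1) M.indep_empty] by blast
  have w: "EM \<subseteq> E" "X0 \<subseteq> EM" "EM \<subseteq> M X0" "indep_wrt (\<lambda>A. N (A \<union> (E - EM))) X0" "indep_wrt M X0"
    using X0 by (auto simp: wave_def)
  define EN where "EN = E - EM"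
  define M' where "M' = (\<lambda>A. M (A \<union> EM))"
  interpret M': closure_matroid M' unfolding M'_def by (rule M.contract)
  interpret Q: closure_pair M' N by unfold_locales
  have st: "state EN M' N {} {}"
    unfolding state_def
  proof (intro conjI allI impI)
    show "indep_wrt M' {}" by (rule M'.indep_empty)
    fix W X assume W: "W \<subseteq> EN - {} - {}" "X \<subseteq> W" "W \<subseteq> M' ({} \<union> X)" "\<forall>x\<in>X. x \<notin> N (X - {x} \<union> (EN - {} - W))"
    have EMX: "EM \<subseteq> M ({} \<union> X0 \<union> X)" using w(3) M.mono[of X0 "{} \<union> X0 \<union> X"] by blast
    then have "X \<union> EM \<subseteq> M ({} \<union> X0 \<union> X)" using M.ext[of "{} \<union> X0 \<union> X"] by blast
    then have "W \<subseteq> M ({} \<union> X0 \<union> X)" using W(3) M.least[of "X \<union> EM"] unfolding M'_def by auto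
    then have 1: "W \<union> EM \<subseteq> M ({} \<union> X0 \<union> X)" using EMX by blast
    have "EN - {} - W = E - (W \<union> EM)" by (auto simp: EN_def)
    then have 2: "indep_wrt (\<lambda>A. N (A \<union> (E - (W \<union> EM)))) X" using W(4) by (simp add: indep_wrt_def)
    \<comment> \<open>A wave left over after contracting \<open>EM\<close> becomes a wave of the
      original pair when glued to the largest one, because \<open>X0\<close> takes over the role of
      \<open>EM\<close> in \<open>M\<close>.\<close>
    have "wave E M N {} (EM \<union> (W \<union> EM)) (X0 \<union> (X - EM))"
      by (rule P.wave_combine[OF X0(1) _ _ _ 1 2]) (use W w in \<open>auto simp: EN_def\<close>)
    then have "W \<subseteq> EM" using Y(2) by blast
    then show "W = {}" using W(1) by (auto simp: EN_def)
  qed auto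
  have split: "x \<in> M' (A \<inter> V)" if "x \<in> M' A" "x \<in> V" for x A
  proof -
    have "x \<in> M ((A \<union> EM) \<inter> V)" using V(2) that unfolding M'_def by blast
    then show ?thesis unfolding M'_def by (rule M.in_mono) auto
  qed
  have split': "x \<in> M' (A - V)" if x: "x \<in> M' A" "x \<notin> V" for x A
  proof -
    obtain F where F: "F \<subseteq> A \<union> EM - V" "x \<in> M F" using V(1)[of x "A \<union> EM"] x unfolding M'_def by blast
    show ?thesis unfolding M'_def by (rule M.in_mono[OF F(2)]) (use F(1) in auto)
  qed
  have "\<exists>I. I \<subseteq> EN \<and> indep_wrt M' I \<and> EN \<subseteq> N I"
  proof (rule Q.cover_of_no_waves[where VN = "- V'" and VM = V])
    show "countable EN" using assms(1) by (simp add: EN_def)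
    show "state EN M' N {} {}" by (rule st)
    fix x A
    show "x \<in> N (A \<inter> - V')" if x: "x \<in> N A" "x \<in> - V'"
    proof -
      obtain F where F: "F \<subseteq> A - V'" "x \<in> N F" using V'(1)[of x A] x by blast
      show ?thesis by (rule N.in_mono[OF F(2)]) (use F(1) in auto)
    qed
    show "x \<in> N (A - - V')" if "x \<in> N A" "x \<notin> - V'"
      using V'(2)[of x A] that by (simp add: Diff_eq)
    show "\<exists>F. finite F \<and> F \<subseteq> A \<and> x \<in> N F" if "x \<in> N A" "x \<in> - V'"
      using V'(1)[of x A] that by blast
    show "\<exists>F. finite F \<and> F \<subseteq> A \<and> x \<in> dual_cl EN N F" if x: "x \<in> dual_cl EN N A" "x \<notin> - V'"
    proof (cases "x \<in> A")
      case True
      then show ?thesis by (intro exI[of _ "{x}"]) (simp add: dual_cl_def)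
    next
      case False
      then have xE: "x \<in> EN" "x \<notin> N (EN - A - {x})" using x by (auto simp: dual_cl_def)
      \<comment> \<open>The dual of \<open>N\<close> restricted to \<open>EN\<close> is the dual of
        \<open>N\<close> with \<open>EM\<close> contracted. So \<open>EM\<close> may help in
        spanning and is dropped from the finite set afterwards.\<close>
      have "EN - A - {x} = E - (A \<union> EM) - {x}" by (auto simp: EN_def)
      then have "x \<in> dual_cl E N (A \<union> EM)" using xE by (simp add: dual_cl_def EN_def)
      then obtain F where F: "finite F" "F \<subseteq> A \<union> EM" "x \<in> dual_cl E N F" using V'(3)[of x "A \<union> EM"] x(2) by blast
      have "x \<notin> F" using F(2) False xE by (auto simp: EN_def)
      then have n: "x \<notin> N (E - F - {x})" using F(3) by (simp add: dual_cl_def)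
      have "EN - F \<inter> A - {x} \<subseteq> E - F - {x}" using F(2) by (auto simp: EN_def)
      then have "x \<notin> N (EN - F \<inter> A - {x})" using n N.mono by blast
      then show ?thesis using xE F by (intro exI[of _ "F \<inter> A"]) (simp add: dual_cl_def)
    qed
    show "x \<in> dual_cl EN M' (A \<inter> V)" if x: "x \<in> dual_cl EN M' A" "x \<in> V"
    proof (rule ccontr)
      assume n: "x \<notin> dual_cl EN M' (A \<inter> V)"
      then have xA: "x \<notin> A" "x \<in> EN" "x \<notin> M' (EN - A - {x})" using x by (auto simp: dual_cl_def)
      then have "x \<in> M' (EN - A \<inter> V - {x})" using n by (simp add: dual_cl_def)
      then have "x \<in> M' ((EN - A \<inter> V - {x}) \<inter> V)" using split x(2) by blast
      then have "x \<in> M' (EN - A - {x})" by (rule M'.in_mono) auto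
      then show False using xA by blast
    qed
    show "x \<in> dual_cl EN M' (A - V)" if x: "x \<in> dual_cl EN M' A" "x \<notin> V"
    proof (rule ccontr)
      assume n: "x \<notin> dual_cl EN M' (A - V)"
      then have xA: "x \<notin> A" "x \<in> EN" "x \<notin> M' (EN - A - {x})" using x by (auto simp: dual_cl_def)
      then have "x \<in> M' (EN - (A - V) - {x})" using n by (simp add: dual_cl_def)
      then have "x \<in> M' ((EN - (A - V) - {x}) - V)" using split' x(2) by blast
      then have "x \<in> M' (EN - A - {x})" by (rule M'.in_mono) auto
      then show False using xA by blast
    qed
    show "\<exists>F. finite F \<and> F \<subseteq> A \<and> x \<in> dual_cl EN M' F" if x: "x \<in> dual_cl EN M' A" "x \<in> V"
    proof (cases "x \<in> A")
      case True
      then show ?thesis by (intro exI[of _ "{x}"]) (simp add: dual_cl_def)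
    next
      case False
      then have xE: "x \<in> EN" "x \<notin> M' (EN - A - {x})" using x by (auto simp: dual_cl_def)
      \<comment> \<open>The dual of \<open>M / EM\<close> is the dual of \<open>M\<close> with
        \<open>EM\<close> deleted, so here the finite set has to avoid \<open>EM\<close>.\<close>
      have e: "EN - B - {x} \<union> EM = E - (B - EM) - {x}" for B using w(1) xE(1) by (auto simp: EN_def)
      have "x \<in> dual_cl E M (A - EM)" using xE e[of A] by (simp add: dual_cl_def EN_def M'_def)
      then obtain F where F: "finite F" "F \<subseteq> A - EM" "x \<in> dual_cl E M F" using V(3)[of x "A - EM"] x(2) by blast
      then have "F - EM = F" "x \<notin> F" using False by auto
      then have "x \<notin> M' (EN - F - {x})" using F(3) e[of F] by (simp add: dual_cl_def M'_def)
      then show ?thesis using xE F by (intro exI[of _ F]) (auto simp: dual_cl_def)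
    qed
    show "\<exists>F. finite F \<and> F \<subseteq> A \<and> x \<in> M' F" if x: "x \<in> M' A" "x \<notin> V"
    proof -
      obtain F where F: "finite F" "F \<subseteq> A \<union> EM - V" "x \<in> M F" using V(1)[of x "A \<union> EM"] x unfolding M'_def by blast
      have "x \<in> M' (F \<inter> A)" unfolding M'_def by (rule M.in_mono[OF F(3)]) (use F(2) in auto)
      then show ?thesis using F by (intro exI[of _ "F \<inter> A"]) auto
    qed
  qed
  then obtain I' where I': "I' \<subseteq> EN" "indep_wrt M' I'" "EN \<subseteq> N I'" by blast
  obtain B where B: "B \<subseteq> I'" "indep_wrt N B" "I' \<subseteq> N B" using N.base[OF N.indep_empty, of I'] by blast
  have ENB: "EN \<subseteq> N B" using I'(3) N.least[OF B(3)] by blast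
  have BEN: "B \<subseteq> EN" using B(1) I'(1) by blast
  have "indep_wrt M (B \<union> X0)"
  proof (rule M.indep_Un[OF w(5) _ w(2)])
    show "indep_wrt (\<lambda>A. M (A \<union> EM)) B"
      using M.indep_over_antimono[of EM I' B EM] I'(2) B(1) by (simp add: M'_def)
  qed
  then have 1: "B \<union> X0 \<in> \<I>M"
    using PM.indep_closure_iff[of "B \<union> X0"] w BEN unfolding M_def EN_def by (simp add: Int_absorb2 subset_iff)
  have "indep_wrt N (X0 \<union> B)" by (rule N.indep_Un[OF B(2) w(4)]) (use BEN in \<open>simp add: EN_def\<close>)
  then have 2: "B \<union> X0 \<in> \<I>N"
    using PN.indep_closure_iff[of "X0 \<union> B"] w BEN unfolding N_def EN_def
    by (simp add: Int_absorb2 subset_iff Un_commute)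
  have e: "(B \<union> X0) \<inter> EM = X0" "(B \<union> X0) \<inter> EN = B" using BEN w(2) by (auto simp: EN_def)
  have "M X0 = span E \<I>M X0" "N B = span E \<I>N B"
    unfolding M_def N_def using w BEN by (auto simp: EN_def intro!: closure_of_eq_span)
  then have "EM \<subseteq> span E \<I>M ((B \<union> X0) \<inter> EM)" "EN \<subseteq> span E \<I>N ((B \<union> X0) \<inter> EN)"
    using w(3) ENB e by auto
  moreover have "EM \<inter> EN = {}" "EM \<union> EN = E" using w(1) by (auto simp: EN_def)
  ultimately show ?thesis using 1 2 by blast
qed

end
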